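(* Let $k\ge 6$ and let $G$ be a planar (finite simple) graph with maximum degree $\Delta\le k$ that has no cycle of length 4. Then $\chi_{gl}''(G)\le k+2$.
   Context: Let $H$ be a graph with an arbitrary fixed orientation and $A$ a group written additively. For $f:E(H)\to A$ and a list assignment $L:V(H)\to 2^A$, an $(A,L,f)$-coloring of $H$ is a map $c:V(H)\to A$ with $c(v)\in L(v)$ for all $v$ and $c(x)-c(y)\neq f(xy)$ for every edge directed from $x$ to $y$. $H$ is $k$-group choosable if for every group $A$ with $|A|\ge k$, every list assignment $L$ with $|L(v)|=k$ for all $v$, and every $f:E(H)\to A$, an $(A,L,f)$-coloring exists; $\chi_{gl}(H)$ is the least such $k$. The total graph $T(G)$ has vertex set $V(G)\cup E(G)$, two elements adjacent iff they are adjacent or incident in $G$; $\chi_{gl}''(G)=\chi_{gl}(T(G))$. *)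

theory Defs
  imports
    "HOL-Analysis.Analysis"
    "HOL-Algebra.Group"
    "Graph_Theory.Pair_Digraph"
begin

text \<open>
  A finite simple undirected graph is a \<^locale>\<open>pair_graph\<close>: a finite loopfree digraph
  whose arc set is symmetric. The undirected edge joining \<open>u\<close> and \<open>v\<close> is represented by
  the two arcs \<open>(u, v)\<close> and \<open>(v, u)\<close>, and, where edges are needed as individual objects,
  by the set \<open>{u, v}\<close>.
\<close>

definition uedges :: "'a pair_pre_digraph \<Rightarrow> 'a set set" where
  "uedges G = (\<lambda>(u, v). {u, v}) ` parcs G"

text \<open>In a symmetric digraph the out-degree of a vertex is its degree as a vertex of the
  undirected graph. The inserted \<open>0\<close> only matters for the graph without vertices.\<close>

definition max_degree :: "'a pair_pre_digraph \<Rightarrow> nat" where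
  "max_degree G = Max (insert 0 (out_degree (with_proj G) ` pverts G))"

text \<open>A plane drawing: \<open>pos\<close> places the vertices, and \<open>\<gamma> e\<close> is a simple (Jordan) arc that
  draws the edge \<open>e\<close>. An arc meets the vertices only in the two ends of its edge, and two
  different arcs meet at most in common ends.\<close>

definition plane_drawing ::
  "'a pair_pre_digraph \<Rightarrow> ('a \<Rightarrow> complex) \<Rightarrow> ('a set \<Rightarrow> real \<Rightarrow> complex) \<Rightarrow> bool" where
  "plane_drawing G pos \<gamma> \<longleftrightarrow>
     inj_on pos (pverts G) \<and>
     (\<forall>e\<in>uedges G.
        arc (\<gamma> e) \<and> {pathstart (\<gamma> e), pathfinish (\<gamma> e)} = pos ` e \<and>
        path_image (\<gamma> e) \<inter> pos ` pverts G = pos ` e) \<and>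
     (\<forall>e\<in>uedges G. \<forall>e'\<in>uedges G. e \<noteq> e' \<longrightarrow>
        path_image (\<gamma> e) \<inter> path_image (\<gamma> e') \<subseteq> pos ` (e \<inter> e'))"

definition planar_graph :: "'a pair_pre_digraph \<Rightarrow> bool" where
  "planar_graph G \<longleftrightarrow> (\<exists>pos \<gamma>. plane_drawing G pos \<gamma>)"

definition total_graph :: "'a pair_pre_digraph \<Rightarrow> ('a + 'a set) pair_pre_digraph" where
  "total_graph G =
     \<lparr> pverts = Inl ` pverts G \<union> Inr ` uedges G,
       parcs = {(Inl u, Inl v) |u v. (u, v) \<in> parcs G}
             \<union> {(Inr e, Inr e') |e e'. e \<in> uedges G \<and> e' \<in> uedges G \<and> e \<noteq> e' \<and> e \<inter> e' \<noteq> {}}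
             \<union> {(Inl v, Inr e) |v e. e \<in> uedges G \<and> v \<in> e}
             \<union> {(Inr e, Inl v) |v e. e \<in> uedges G \<and> v \<in> e} \<rparr>"

text \<open>An orientation keeps exactly one of the two arcs of every undirected edge.\<close>

definition orientation :: "'a pair_pre_digraph \<Rightarrow> 'a rel \<Rightarrow> bool" where
  "orientation H D \<longleftrightarrow>
     D \<subseteq> parcs H \<and> (\<forall>x y. (x, y) \<in> parcs H \<longrightarrow> ((x, y) \<in> D \<longleftrightarrow> (y, x) \<notin> D))"

text \<open>Groups need not be commutative. \<^theory>\<open>HOL-Algebra.Group\<close> writes them multiplicatively,
  so that the difference \<open>c x - c y\<close> is \<open>c x \<otimes> inv (c y)\<close>.\<close>

definition group_coloring ::
  "'a pair_pre_digraph \<Rightarrow> 'a rel \<Rightarrow> 'g monoid \<Rightarrow> ('a \<Rightarrow> 'g set) \<Rightarrow> ('a \<times> 'a \<Rightarrow> 'g)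
   \<Rightarrow> ('a \<Rightarrow> 'g) \<Rightarrow> bool" where
  "group_coloring H D A L f c \<longleftrightarrow>
     (\<forall>v\<in>pverts H. c v \<in> L v) \<and>
     (\<forall>x y. (x, y) \<in> D \<longrightarrow> c x \<otimes>\<^bsub>A\<^esub> inv\<^bsub>A\<^esub> c y \<noteq> f (x, y))"

text \<open>HOL cannot quantify over all types inside a definition, so the quantifier ``for every
  group'' ranges over all groups whose carrier is a subset of the type \<open>'g\<close>. Leaving \<open>'g\<close> a
  type variable in a theorem covers all groups. The orientation is quantified
  universally; reversing the arc \<open>(x, y)\<close> amounts to replacing \<open>f (x, y)\<close> by its inverse.\<close>

definition group_choosable :: "'g itself \<Rightarrow> 'a pair_pre_digraph \<Rightarrow> nat \<Rightarrow> bool" where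
  "group_choosable _ H k \<longleftrightarrow>
     (\<forall>D (A :: 'g monoid) L f.
        orientation H D \<and> group A \<and> (infinite (carrier A) \<or> k \<le> card (carrier A)) \<and>
        (\<forall>v\<in>pverts H. L v \<subseteq> carrier A \<and> finite (L v) \<and> card (L v) = k) \<and>
        f ` D \<subseteq> carrier A
        \<longrightarrow> (\<exists>c. group_coloring H D A L f c))"

definition group_choice_number :: "'g itself \<Rightarrow> 'a pair_pre_digraph \<Rightarrow> nat" where
  "group_choice_number T H = (LEAST k. group_choosable T H k)"

definition total_group_choice_number :: "'g itself \<Rightarrow> 'a pair_pre_digraph \<Rightarrow> nat" where
  "total_group_choice_number T G = group_choice_number T (total_graph G)"

lemma pair_graph_total_graph:
  assumes "pair_graph G"
  shows "pair_graph (total_graph G)"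
proof -
  interpret pair_graph G by fact
  have fE: "finite (uedges G)"
    using pair_finite_arcs by (simp add: uedges_def)
  have sub: "e \<subseteq> pverts G" if "e \<in> uedges G" for e
    using that by (auto simp: uedges_def dest: in_arcsD1 in_arcsD2)
  have fV: "finite (pverts (total_graph G))"
    using fE pair_finite_verts by (simp add: total_graph_def)
  have s: "(v, u) \<in> parcs G" if "(u, v) \<in> parcs G" for u v
    using pair_sym_arcs that by (auto simp: symmetric_def dest: symD)
  have wf: "parcs (total_graph G) \<subseteq> pverts (total_graph G) \<times> pverts (total_graph G)"
    using sub by (auto simp: total_graph_def dest: in_arcsD1 in_arcsD2)
  show ?thesis
  proof
    show "finite (parcs (total_graph G))"
      using finite_subset[OF wf] fV by blast
    show "symmetric (with_proj (total_graph G))"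
      by (auto simp: symmetric_def total_graph_def intro!: symI dest: s)
    show "fst e \<noteq> snd e" if "e \<in> parcs (total_graph G)" for e
      using that by (auto simp: total_graph_def dest: no_loops')
  qed (use wf fV in auto)
qed

text \<open>The least \<open>k\<close> in \<^const>\<open>group_choice_number\<close> exists for every finite graph, and
  choosability is monotone, so that bounding the number is the same as choosability.\<close>

lemma group_choosable_card:
  fixes H :: "'a pair_pre_digraph"
  assumes "pair_graph H"
  shows "group_choosable TYPE('g) H (card (pverts H))"
  unfolding group_choosable_def
proof (intro allI impI, elim conjE)
  interpret pair_graph H by fact
  fix D and A :: "'g monoid" and L f
  assume D: "orientation H D" and A: "group A"
    and L: "\<forall>v\<in>pverts H. L v \<subseteq> carrier A \<and> finite (L v) \<and> card (L v) = card (pverts H)"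
    and f: "f ` D \<subseteq> carrier A"
  interpret A: group A by fact
  have "\<exists>c. (\<forall>v\<in>W. c v \<in> L v) \<and>
          (\<forall>x\<in>W. \<forall>y\<in>W. (x, y) \<in> D \<longrightarrow> c x \<otimes>\<^bsub>A\<^esub> inv\<^bsub>A\<^esub> c y \<noteq> f (x, y))"
    if "finite W" "W \<subseteq> pverts H" for W
    using that
  proof (induction W)
    case empty
    then show ?case by simp
  next
    case (insert v W)
    then obtain c where c: "\<And>w. w \<in> W \<Longrightarrow> c w \<in> L w"
      "\<And>x y. \<lbrakk>x \<in> W; y \<in> W; (x, y) \<in> D\<rbrakk> \<Longrightarrow> c x \<otimes>\<^bsub>A\<^esub> inv\<^bsub>A\<^esub> c y \<noteq> f (x, y)"
      by (metis insert_subset)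
    define g where "g w = (if (v, w) \<in> D then f (v, w) \<otimes>\<^bsub>A\<^esub> c w
                            else inv\<^bsub>A\<^esub> f (w, v) \<otimes>\<^bsub>A\<^esub> c w)" for w
    have "card (g ` W) \<le> card W"
      using insert.hyps(1) by (rule card_image_le)
    also have "\<dots> < card (insert v W)"
      using insert.hyps by simp
    also have "\<dots> \<le> card (L v)"
      using insert.prems L card_mono[OF pair_finite_verts] by auto
    finally obtain a where a: "a \<in> L v" "a \<notin> g ` W"
      by (metis card_mono finite_imageI insert.hyps(1) leD subsetI)
    have aA: "a \<in> carrier A" using a L insert.prems by auto
    have cA: "c w \<in> carrier A" if "w \<in> W" for w
      using c(1) that L insert.prems by blast
    have irr: "(x, x) \<notin> D" for x
      using D no_loops' by (auto simp: orientation_def)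
    have "a \<otimes>\<^bsub>A\<^esub> inv\<^bsub>A\<^esub> c w \<noteq> f (v, w)" if "w \<in> W" "(v, w) \<in> D" for w
    proof
      assume "a \<otimes>\<^bsub>A\<^esub> inv\<^bsub>A\<^esub> c w = f (v, w)"
      then have "a = f (v, w) \<otimes>\<^bsub>A\<^esub> c w"
        using aA cA[OF that(1)] A.inv_solve_right' f that(2)
        by (metis A.inv_closed A.m_assoc A.l_inv A.r_one)
      then show False using a(2) that by (auto simp: g_def)
    qed
    moreover have "c w \<otimes>\<^bsub>A\<^esub> inv\<^bsub>A\<^esub> a \<noteq> f (w, v)" if "w \<in> W" "(w, v) \<in> D" for w
    proof
      assume *: "c w \<otimes>\<^bsub>A\<^esub> inv\<^bsub>A\<^esub> a = f (w, v)"
      then have "inv\<^bsub>A\<^esub> f (w, v) = a \<otimes>\<^bsub>A\<^esub> inv\<^bsub>A\<^esub> c w"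
        using aA cA[OF that(1)] by (metis A.inv_closed A.inv_inv A.inv_mult_group)
      then have "a = inv\<^bsub>A\<^esub> f (w, v) \<otimes>\<^bsub>A\<^esub> c w"
        using aA cA[OF that(1)] by (simp add: A.m_assoc)
      moreover have "(v, w) \<notin> D"
        using D that(2) unfolding orientation_def by blast
      ultimately show False using a(2) that by (auto simp: g_def)
    qed
    ultimately show ?case
      using c a(1) insert.hyps(2) irr by (intro exI[of _ "c(v := a)"]) auto
  qed
  from this[OF pair_finite_verts subset_refl] obtain c where
    c: "\<forall>v\<in>pverts H. c v \<in> L v"
       "\<forall>x\<in>pverts H. \<forall>y\<in>pverts H. (x, y) \<in> D \<longrightarrow> c x \<otimes>\<^bsub>A\<^esub> inv\<^bsub>A\<^esub> c y \<noteq> f (x, y)"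
    by blast
  moreover have "x \<in> pverts H \<and> y \<in> pverts H" if "(x, y) \<in> D" for x y
    using D that by (auto simp: orientation_def dest: in_arcsD1 in_arcsD2)
  ultimately show "\<exists>c. group_coloring H D A L f c"
    unfolding group_coloring_def by blast
qed

lemma group_choosable_mono:
  fixes H :: "'a pair_pre_digraph"
  assumes "group_choosable TYPE('g) H k" "k \<le> l"
  shows "group_choosable TYPE('g) H l"
  unfolding group_choosable_def
proof (intro allI impI, elim conjE)
  fix D and A :: "'g monoid" and L f
  assume D: "orientation H D" and A: "group A"
    and l: "infinite (carrier A) \<or> l \<le> card (carrier A)"
    and L: "\<forall>v\<in>pverts H. L v \<subseteq> carrier A \<and> finite (L v) \<and> card (L v) = l"
    and f: "f ` D \<subseteq> carrier A"
  have "\<exists>M. M \<subseteq> L v \<and> finite M \<and> card M = k" if "v \<in> pverts H" for v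
    using L that assms(2) by (metis obtain_subset_with_card_n)
  then obtain M where M: "\<And>v. v \<in> pverts H \<Longrightarrow> M v \<subseteq> L v \<and> finite (M v) \<and> card (M v) = k"
    by metis
  moreover have "infinite (carrier A) \<or> k \<le> card (carrier A)"
    using l assms(2) by auto
  moreover have "\<forall>v\<in>pverts H. M v \<subseteq> carrier A \<and> finite (M v) \<and> card (M v) = k"
    using M L by blast
  ultimately obtain c where "group_coloring H D A M f c"
    using assms(1) D A f unfolding group_choosable_def by blast
  then show "\<exists>c. group_coloring H D A L f c"
    using M unfolding group_coloring_def by blast
qed

lemma group_choice_number_le_iff:
  fixes H :: "'a pair_pre_digraph"
  assumes "pair_graph H"
  shows "group_choice_number TYPE('g) H \<le> k \<longleftrightarrow> group_choosable TYPE('g) H k"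
  using group_choosable_mono LeastI[of "group_choosable TYPE('g) H", OF group_choosable_card[OF assms]]
    Least_le[of "group_choosable TYPE('g) H"]
  unfolding group_choice_number_def by blast

end

(*
  Induction on the number of edges. An edge uv with 2 d(u) <= k + 1 and d(u) + d(v) <= k + 2
  can be deleted: after colouring the rest, uncolour u, then colour uv and u greedily.
  An edge uv of a triangle uvw whose vertices all have degree at most 4 can be deleted as well:
  uncolour u, v, w; then u, v, uv, w induce a diamond in which every element has at
  least as many free colours as neighbours.

  A planar graph without 4-cycles contains one of these configurations. Euler's formula
  enters as follows. By Janiszewski's theorem a connected plane graph with n vertices and
  m edges has at most m - n + 2 faces. The edge sets with all degrees even form a group of
  order at least 2^(m-n+1); each of them has an "inside modulo 2", which is a set of faces
  and determines the edge set. Hence every set of faces avoiding the outer one occurs, and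
  single faces give m - n + 1 distinct nonempty even sets that cover each edge at most twice.
  Each of these has at least 5 edges or is one of the t triangles, so 3m + 5 <= 5n + 2t. On the other
  hand the weights 3 - 10/d(u) + 3 - 10/d(v) of the edges uv sum to 6m - 10n; if no
  configuration occurs they are nonnegative and sum to at least 4 on each triangle, and
  triangles share no edges, so 6m - 10n >= 4t, a contradiction.
*)
theory Submission
  imports Defs "HOL-Complex_Analysis.Winding_Numbers"
begin

section \<open>Even edge sets\<close>

text \<open>Face boundaries are never traced: in a plane graph with bridges or cut vertices they
  need not be cycles. Topology supplies only an upper bound for the number of faces and the fact
  that an even set is determined by its signs on them; an induction over the edges supplies enough
  even sets. The two counts meet, which yields Euler's formula and the basis at once. The inside
  modulo 2 is a product of signs of single edges, so it is available for every even set without a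
  decomposition into cycles, and symmetric difference becomes multiplication. The weights come from
  rewriting \<open>3m + 5 <= 5n + 2t\<close> as a bound on the sum of \<open>3 d(v) - 10\<close>
  over the vertices. For the colouring, the group is abstracted to the fact that across an edge a
  colour conflicts with at most one colour. The bound \<open>k >= 6\<close> provides lists of size
  8, just enough for a light triangle, and makes the edges with \<open>d(u) <= 2\<close>, or with
  \<open>d(u) = 3\<close> and \<open>d(v) <= 5\<close>, deletable.\<close>

definition deg :: "'a set set \<Rightarrow> 'a \<Rightarrow> nat" where
  "deg F v = card {e \<in> F. v \<in> e}"

text \<open>The binary cycle space of the graph with edge set \<open>F\<close>; its addition is
  \<open>sym_diff\<close>.\<close>

definition even_sets :: "'a set set \<Rightarrow> 'a set set set" where
  "even_sets F = {z. z \<subseteq> F \<and> (\<forall>v. even (deg z v))}"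

definition adj_rel :: "'a set set \<Rightarrow> 'a rel" where
  "adj_rel F = {(a, b). {a, b} \<in> F}"

definition C4_free :: "'a set set \<Rightarrow> bool" where
  "C4_free F \<longleftrightarrow> (\<forall>a b c d. {a, b} \<in> F \<longrightarrow> {b, c} \<in> F \<longrightarrow> {c, d} \<in> F \<longrightarrow> {d, a} \<in> F \<longrightarrow> \<not> distinct [a, b, c, d])"

text \<open>A triangle is the set of its three edges, so that it can be compared with the elements
  of \<open>even_sets F\<close>.\<close>

definition triangles :: "'a set set \<Rightarrow> 'a set set set" where
  "triangles F = {T. T \<subseteq> F \<and> (\<exists>a b c. distinct [a, b, c] \<and> T = {{a, b}, {b, c}, {a, c}})}"

lemma even_card_sym_diff:
  assumes "finite A" "finite B"
  shows "even (card (sym_diff A B)) \<longleftrightarrow> (even (card A) \<longleftrightarrow> even (card B))"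
proof -
  have "card A = card (A - B) + card (A \<inter> B)" "card B = card (B - A) + card (A \<inter> B)"
    using assms card_Int_Diff[of A B] card_Int_Diff[of B A] by (simp_all add: Int_commute)
  moreover have "card (sym_diff A B) = card (A - B) + card (B - A)"
    using assms by (intro card_Un_disjoint) auto
  ultimately show ?thesis
    by (cases "even (card (A \<inter> B))") simp_all
qed

lemma even_deg_sym_diff:
  assumes "finite y" "finite z"
  shows "even (deg (sym_diff y z) v) \<longleftrightarrow> (even (deg y v) \<longleftrightarrow> even (deg z v))"
proof -
  have "{e \<in> sym_diff y z. v \<in> e} = sym_diff {e \<in> y. v \<in> e} {e \<in> z. v \<in> e}"
    by auto
  then show ?thesis
    using assms by (simp add: deg_def even_card_sym_diff)
qed

lemma even_sets_sym_diff:
  assumes "finite F" "y \<in> even_sets F" "z \<in> even_sets F"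
  shows "sym_diff y z \<in> even_sets F"
proof -
  have "finite y" "finite z"
    using assms by (auto simp: even_sets_def intro: finite_subset)
  then show ?thesis
    using assms even_deg_sym_diff[of y z] by (auto simp: even_sets_def)
qed

lemma finite_even_sets: "finite F \<Longrightarrow> finite (even_sets F)"
  by (rule finite_subset[of _ "Pow F"]) (auto simp: even_sets_def)

lemma even_sets_mono: "F \<subseteq> F' \<Longrightarrow> even_sets F \<subseteq> even_sets F'"
  by (auto simp: even_sets_def)

lemma deg_insert:
  assumes "finite F" "e \<notin> F"
  shows "deg (insert e F) v = deg F v + (if v \<in> e then 1 else 0)"
proof -
  have "{f \<in> insert e F. v \<in> f} = (if v \<in> e then insert e {f \<in> F. v \<in> f} else {f \<in> F. v \<in> f})"
    by auto
  then show ?thesis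
    using assms by (simp add: deg_def)
qed

lemma deg_mono: "finite F \<Longrightarrow> F' \<subseteq> F \<Longrightarrow> deg F' v \<le> deg F v"
  unfolding deg_def by (intro card_mono) auto

lemma sum_deg:
  assumes "finite X" "finite F"
  shows "(\<Sum>v\<in>X. deg F v) = (\<Sum>f\<in>F. card (f \<inter> X))"
proof -
  have "deg F v = (\<Sum>f\<in>F. if v \<in> f then 1 else 0)" for v
    using assms(2) by (simp add: deg_def sum.If_cases Int_def)
  moreover have "card (f \<inter> X) = (\<Sum>v\<in>X. if v \<in> f then 1 else 0)" for f
    using assms(1) by (simp add: sum.If_cases Int_def conj_commute)
  ultimately show ?thesis
    by (simp add: sum.swap[of _ X F])
qed

section \<open>Reachability, bridges, paths and growing connected subgraphs\<close>

lemma sym_adj_rel: "sym (adj_rel F)"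
  by (auto simp: sym_def adj_rel_def insert_commute)

lemma adj_rtrancl_sym: "(x, y) \<in> (adj_rel F)\<^sup>* \<Longrightarrow> (y, x) \<in> (adj_rel F)\<^sup>*"
  by (meson sym_adj_rel sym_rtrancl symD)

lemma adj_rtrancl_mono: "(x, y) \<in> (adj_rel F)\<^sup>* \<Longrightarrow> F \<subseteq> F' \<Longrightarrow> (x, y) \<in> (adj_rel F')\<^sup>*"
  by (rule subsetD[OF rtrancl_mono]) (auto simp: adj_rel_def)

text \<open>Double counting of the incidences between \<open>z\<close> and the component
  \<open>X\<close> of \<open>u\<close> in \<open>F - {{u, w}}\<close>. Even degrees make their
  number even, and every edge of \<open>z\<close> other than \<open>uw\<close> has none or both of
  its ends in \<open>X\<close>; if \<open>w\<close> were not in \<open>X\<close>, the edge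
  \<open>uw\<close> would contribute the only odd term.\<close>

lemma even_set_edge_not_bridge:
  assumes "finite F" "\<forall>e\<in>F. card e = 2" "z \<in> even_sets F" "{u, w} \<in> z" "u \<noteq> w"
  shows "(u, w) \<in> (adj_rel (F - {{u, w}}))\<^sup>*"
proof (rule ccontr)
  assume notin: "(u, w) \<notin> (adj_rel (F - {{u, w}}))\<^sup>*"
  define X where "X = {x \<in> insert u (\<Union>z). (u, x) \<in> (adj_rel (F - {{u, w}}))\<^sup>*}"
  have z: "z \<subseteq> F" "\<And>v. even (deg z v)" "finite z"
    using assms(1,3) by (auto simp: even_sets_def intro: finite_subset)
  have fin: "finite f" if "f \<in> z" for f
    using assms(2) z(1) that by (metis card.infinite subsetD zero_neq_numeral)
  then have "finite X"
    using z(3) by (auto simp: X_def)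
  then have ev: "even (\<Sum>f\<in>z. card (f \<inter> X))"
    unfolding sum_deg[OF \<open>finite X\<close> z(3), symmetric] using z(2) by (simp add: dvd_sum)
  have split: "(\<Sum>f\<in>z. card (f \<inter> X)) = card ({u, w} \<inter> X) + (\<Sum>f\<in>z - {{u, w}}. card (f \<inter> X))"
    using z(3) assms(4) by (simp add: sum.remove)
  have uX: "{u, w} \<inter> X = {u}"
    using notin assms(4) by (auto simp: X_def)
  have "even (card (f \<inter> X))" if f: "f \<in> z - {{u, w}}" for f
  proof -
    obtain a b where ab: "f = {a, b}" "a \<noteq> b"
      using assms(2) z(1) f by (metis DiffD1 card_2_iff subsetD)
    have "(a, b) \<in> adj_rel (F - {{u, w}})" "(b, a) \<in> adj_rel (F - {{u, w}})"
      using f z(1) ab by (auto simp: adj_rel_def insert_commute)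
    then have "a \<in> X \<longleftrightarrow> b \<in> X"
      using f ab by (auto simp: X_def intro: rtrancl_into_rtrancl)
    then show ?thesis
      using ab by (cases "a \<in> X") auto
  qed
  then have "even (\<Sum>f\<in>z - {{u, w}}. card (f \<inter> X))"
    by (rule dvd_sum)
  with ev split show False
    unfolding uX by simp
qed

text \<open>\<open>W\<close> and \<open>P\<close> are the vertices and the edges of a path from
  \<open>u\<close> to \<open>v\<close>. No sequence is recorded, since degrees and drawn images
  depend on these sets only.\<close>

inductive simple_walk :: "'a set set \<Rightarrow> 'a \<Rightarrow> 'a set \<Rightarrow> 'a set set \<Rightarrow> 'a \<Rightarrow> bool" for F u where
  start: "simple_walk F u {u} {} u"
| step: "simple_walk F u W P v \<Longrightarrow> {v, w} \<in> F \<Longrightarrow> w \<notin> W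
           \<Longrightarrow> simple_walk F u (insert w W) (insert {v, w} P) w"

lemma simple_walk_facts:
  assumes "simple_walk F u W P v"
  shows "finite P" "P \<subseteq> F" "\<Union>P \<subseteq> W" "u \<in> W" "v \<in> W"
  using assms by (induction) auto

lemma simple_walk_odd_deg:
  assumes "simple_walk F u W P v"
  shows "odd (deg P x) \<longleftrightarrow> (x = u) \<noteq> (x = v)"
  using assms
proof (induction)
  case start
  then show ?case by (simp add: deg_def)
next
  case (step W P v w)
  have "{v, w} \<notin> P" "finite P" "v \<noteq> w" "u \<noteq> w"
    using simple_walk_facts[OF step.hyps(1)] step.hyps(3) by auto
  then show ?case
    using step.IH by (auto simp: deg_insert)
qed

lemma simple_walk_prefix:
  assumes "simple_walk F u W P v" "x \<in> W"
  shows "\<exists>W P. simple_walk F u W P x"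
  using assms by (induction) (auto intro: simple_walk.intros)

text \<open>If the next vertex has been visited already, the path is cut back to it by
  \<open>simple_walk_prefix\<close>; otherwise it is extended.\<close>

lemma ex_simple_walk:
  assumes "(u, v) \<in> (adj_rel F)\<^sup>*"
  shows "\<exists>W P. simple_walk F u W P v"
  using assms
proof (induction)
  case base
  then show ?case by (auto intro: simple_walk.start)
next
  case (step v w)
  then obtain W P where "simple_walk F u W P v" by blast
  moreover have "{v, w} \<in> F"
    using step.hyps(2) by (simp add: adj_rel_def)
  ultimately show ?case
    by (cases "w \<in> W") (blast intro: simple_walk.step dest: simple_walk_prefix)+
qed

text \<open>The path has odd degree exactly at \<open>u\<close> and \<open>w\<close>, and the
  closing edge repairs both.\<close>

lemma simple_walk_closed_even:
  assumes "simple_walk F u W P w" "u \<noteq> w" "{u, w} \<notin> P" "insert {u, w} P \<subseteq> F'"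
  shows "insert {u, w} P \<in> even_sets F'"
  using assms simple_walk_odd_deg[OF assms(1)] simple_walk_facts(1)[OF assms(1)]
  by (auto simp: even_sets_def deg_insert)

text \<open>The connected subgraphs containing \<open>r\<close>, built edge by edge. A pendant edge
  preserves \<open>card F + 1 - card W\<close> and a chord raises it by one, so that even sets and
  faces can be counted by the same induction.\<close>

inductive grown :: "'a set set \<Rightarrow> 'a \<Rightarrow> 'a set \<Rightarrow> 'a set set \<Rightarrow> bool" for E r where
  root: "grown E r {r} {}"
| pendant: "grown E r W F \<Longrightarrow> u \<in> W \<Longrightarrow> w \<notin> W \<Longrightarrow> {u, w} \<in> E
              \<Longrightarrow> grown E r (insert w W) (insert {u, w} F)"
| chord: "grown E r W F \<Longrightarrow> u \<in> W \<Longrightarrow> w \<in> W \<Longrightarrow> {u, w} \<in> E \<Longrightarrow> {u, w} \<notin> F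
              \<Longrightarrow> grown E r W (insert {u, w} F)"

lemma grown_facts:
  assumes "grown E r W F"
  shows "finite W" "finite F" "F \<subseteq> E" "\<Union>F \<subseteq> W" "r \<in> W"
  using assms by (induction) auto

lemma grown_reach_root:
  assumes "grown E r W F"
  shows "\<forall>x\<in>W. (r, x) \<in> (adj_rel F)\<^sup>*"
  using assms
proof (induction)
  case root
  then show ?case by simp
next
  case (pendant W F u w)
  have "(r, x) \<in> (adj_rel (insert {u, w} F))\<^sup>*" if "x \<in> W" for x
    using pendant.IH that by (blast intro: adj_rtrancl_mono)
  moreover have "(u, w) \<in> adj_rel (insert {u, w} F)"
    by (simp add: adj_rel_def)
  ultimately show ?case
    using pendant.hyps(2) by (auto intro: rtrancl_into_rtrancl)
next
  case (chord W F u w)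
  then show ?case by (blast intro: adj_rtrancl_mono)
qed

lemma grown_connected:
  assumes "grown E r W F" "x \<in> W" "y \<in> W"
  shows "(x, y) \<in> (adj_rel F)\<^sup>*"
  using grown_reach_root[OF assms(1)] assms(2,3) by (meson adj_rtrancl_sym rtrancl_trans)

text \<open>A grown subgraph with the most edges is the whole component of \<open>r\<close>, because
  an edge at \<open>W\<close> outside \<open>F\<close> could still be added as a pendant edge or a
  chord.\<close>

lemma grown_maximal:
  assumes "finite E"
  obtains W F where "grown E r W F" "\<And>u w. u \<in> W \<Longrightarrow> {u, w} \<in> E \<Longrightarrow> w \<in> W \<and> {u, w} \<in> F"
proof -
  have "\<exists>n. (\<exists>W F. grown E r W F \<and> card F = n) \<and> (\<forall>m. (\<exists>W F. grown E r W F \<and> card F = m) \<longrightarrow> m \<le> n)"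
  proof (rule Nat.ex_has_greatest_nat[where P = "\<lambda>n. \<exists>W F. grown E r W F \<and> card F = n" and b = "card E"])
    show "\<exists>W F. grown E r W F \<and> card F = 0"
      by (metis grown.root card.empty)
    show "\<forall>y. (\<exists>W F. grown E r W F \<and> card F = y) \<longrightarrow> y \<le> card E"
      by (metis grown_facts(3) assms card_mono)
  qed
  then obtain W F where WF: "grown E r W F" "\<And>W' F'. grown E r W' F' \<Longrightarrow> card F' \<le> card F"
    by blast
  have "w \<in> W \<and> {u, w} \<in> F" if "u \<in> W" "{u, w} \<in> E" for u w
  proof (rule ccontr)
    assume *: "\<not> (w \<in> W \<and> {u, w} \<in> F)"
    then have "{u, w} \<notin> F"
      using grown_facts(4)[OF WF(1)] by auto
    then have "\<exists>W'. grown E r W' (insert {u, w} F)"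
      using grown.pendant[OF WF(1) that(1) _ that(2)] grown.chord[OF WF(1) that(1) _ that(2)] by blast
    then show False
      using WF(2) grown_facts(2)[OF WF(1)] \<open>{u, w} \<notin> F\<close> by fastforce
  qed
  then show ?thesis
    using that WF(1) by blast
qed

text \<open>A chord closes a path of \<open>F\<close> to an even set \<open>c\<close>. Adding
  \<open>c\<close> maps the old even sets injectively to even sets containing the chord, so their
  number at least doubles. The first conjunct keeps the truncated subtraction exact.\<close>

lemma grown_card_even_sets:
  assumes "grown E r W F" "\<forall>e\<in>E. card e = 2"
  shows "card W \<le> card F + 1 \<and> 2 ^ (card F + 1 - card W) \<le> card (even_sets F)"
  using assms(1)
proof (induction)
  case root
  have "even_sets {} = {{} :: 'a set set}"
    by (auto simp: even_sets_def deg_def)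
  then show ?case by simp
next
  case (pendant W F u w)
  note f = grown_facts[OF pendant.hyps(1)]
  have "{u, w} \<notin> F"
    using f(4) pendant.hyps(3) by auto
  moreover have "card (even_sets F) \<le> card (even_sets (insert {u, w} F))"
    by (intro card_mono finite_even_sets even_sets_mono) (use f in auto)
  ultimately show ?case
    using pendant f by auto
next
  case (chord W F u w)
  note f = grown_facts[OF chord.hyps(1)]
  let ?F = "insert {u, w} F"
  have "u \<noteq> w"
    using assms(2) chord.hyps(4) by fastforce
  obtain X P where P: "simple_walk F u X P w"
    using ex_simple_walk grown_connected[OF chord.hyps(1-3)] by metis
  define c where "c = insert {u, w} P"
  have notP: "{u, w} \<notin> P"
    using simple_walk_facts(2)[OF P] chord.hyps(5) by blast
  have c: "c \<in> even_sets ?F"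
    unfolding c_def by (rule simple_walk_closed_even[OF P \<open>u \<noteq> w\<close> notP])
      (use simple_walk_facts(2)[OF P] in auto)
  let ?g = "\<lambda>z. sym_diff z c"
  have "inj_on ?g (even_sets F)"
    by (rule inj_on_inverseI[of _ ?g]) auto
  then have "card (?g ` even_sets F) = card (even_sets F)"
    by (rule card_image)
  moreover have "even_sets F \<inter> ?g ` even_sets F = {}"
  proof -
    have 1: "{u, w} \<notin> z" if "z \<in> even_sets F" for z
      using that chord.hyps(5) by (auto simp: even_sets_def)
    have "?g z \<notin> even_sets F" if "z \<in> even_sets F" for z
      using 1[OF that] 1[of "?g z"] by (auto simp: c_def)
    then show ?thesis
      unfolding disjoint_iff by (auto simp del: Un_iff)
  qed
  moreover have "even_sets F \<union> ?g ` even_sets F \<subseteq> even_sets ?F"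
  proof (intro Un_least image_subsetI)
    show F: "even_sets F \<subseteq> even_sets ?F"
      by (intro even_sets_mono) auto
    show "?g z \<in> even_sets ?F" if "z \<in> even_sets F" for z
      using F that f(2) by (intro even_sets_sym_diff c) auto
  qed
  ultimately have "2 * card (even_sets F) \<le> card (even_sets ?F)"
    using card_mono[of "even_sets ?F" "even_sets F \<union> ?g ` even_sets F"] f(2)
    by (simp add: finite_even_sets card_Un_disjoint)
  then show ?case
    using chord f by (auto simp: Suc_diff_le)
qed

section \<open>Small even sets in graphs without 4-cycles\<close>

lemma deg_even_other_edge:
  assumes "finite z" "even (deg z v)" "e \<in> z" "v \<in> e"
  obtains f where "f \<in> z" "v \<in> f" "f \<noteq> e"
proof -
  have "{f \<in> z. v \<in> f} \<noteq> {e}"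
  proof
    assume "{f \<in> z. v \<in> f} = {e}"
    then have "deg z v = 1" by (simp add: deg_def)
    then show False using assms(2) by simp
  qed
  then show ?thesis using that assms by blast
qed

text \<open>An edge \<open>ab\<close> of \<open>z\<close> continues at both ends, by
  \<open>ac\<close> and \<open>bd\<close>. If \<open>c = d\<close>, this is a triangle, and what
  remains of \<open>z\<close> is again even. Otherwise \<open>cd\<close> is not in \<open>z\<close>,
  as it would close a 4-cycle; hence \<open>c\<close> and \<open>d\<close> need one further edge
  each, and these are different.\<close>

lemma even_set_triangle_or_large:
  assumes "finite F" "\<forall>e\<in>F. card e = 2" "C4_free F" "z \<in> even_sets F" "z \<noteq> {}"
  shows "z \<in> triangles F \<and> card z = 3 \<or> 5 \<le> card z"
proof -
  have z: "z \<subseteq> F" "\<And>v. even (deg z v)" "finite z"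
    using assms(1,4) by (auto simp: even_sets_def intro: finite_subset)
  have other: "\<exists>y. {x, y} \<in> z \<and> y \<noteq> x \<and> y \<noteq> a" if xa: "{x, a} \<in> z" for x a
  proof -
    obtain f where f: "f \<in> z" "x \<in> f" "f \<noteq> {x, a}"
      by (rule deg_even_other_edge[of z x "{x, a}"]) (use z(2,3) xa in auto)
    then obtain p q where pq: "f = {p, q}" "p \<noteq> q"
      using assms(2) z(1) by (metis card_2_iff subsetD)
    then have "f = {x, p} \<and> p \<noteq> x \<or> f = {x, q} \<and> q \<noteq> x"
      using f(2) by auto
    then show ?thesis
      using f by auto
  qed
  obtain e where "e \<in> z" using assms(5) by blast
  then obtain a b where ab: "{a, b} \<in> z" "a \<noteq> b"
    using assms(2) z(1) by (metis card_2_iff subsetD)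
  obtain c where c: "{a, c} \<in> z" "c \<noteq> a" "c \<noteq> b"
    using other[OF ab(1)] by blast
  obtain d where d: "{b, d} \<in> z" "d \<noteq> b" "d \<noteq> a"
    using other[of b a] ab by (auto simp: insert_commute)
  have five: "5 \<le> card z" if "{{a, b}, {a, c}, {b, d}, f, g} \<subseteq> z"
    "card {{a, b}, {a, c}, {b, d}, f, g} = 5" for f g
    using card_mono[OF z(3) that(1)] that(2) by simp
  show ?thesis
  proof (cases "c = d")
    case True
    define T where "T = {{a, b}, {b, c}, {a, c}}"
    have T: "T \<subseteq> z" "card T = 3" "finite T"
      using ab c d True by (auto simp: T_def doubleton_eq_iff)
    have tri: "T \<in> triangles F"
      using T(1) z(1) ab c by (auto simp: triangles_def T_def)
    show ?thesis
    proof (cases "z = T")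
      case True
      then show ?thesis using tri T by simp
    next
      case False
      have Teven: "even (deg T v)" for v
      proof -
        have "deg {} v = 0" by (simp add: deg_def)
        then show ?thesis
          using ab c by (simp add: T_def deg_insert doubleton_eq_iff)
      qed
      \<comment> \<open>A single further edge would give its ends odd degree.\<close>
      have "card (z - T) \<noteq> 1"
      proof
        assume "card (z - T) = 1"
        then obtain f where f: "z - T = {f}"
          by (metis card_1_singletonE)
        then have "z = insert f T" "f \<notin> T"
          using T(1) by blast+
        moreover have "card f = 2"
          using f assms(2) z(1) by blast
        then obtain v where "v \<in> f"
          by (metis card.empty ex_in_conv zero_neq_numeral)
        ultimately show False
          using deg_insert[OF T(3), of f v] Teven[of v] z(2)[of v] by simp
      qed
      moreover have "card (z - T) \<noteq> 0"
        using False T(1) z(3) by simp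
      moreover have "card z = card (z - T) + 3"
        using T z(3) by (metis card_Diff_subset card_mono le_add_diff_inverse2)
      ultimately show ?thesis by linarith
    qed
  next
    case cd: False
    have no: "{c, d} \<notin> z"
    proof
      assume "{c, d} \<in> z"
      then have "{a, b} \<in> F" "{b, d} \<in> F" "{d, c} \<in> F" "{c, a} \<in> F"
        using z(1) ab c d by (auto simp: insert_commute)
      then show False
        using assms(3)[unfolded C4_free_def, rule_format, of a b d c] ab c d cd by auto
    qed
    obtain x where x: "{c, x} \<in> z" "x \<noteq> c" "x \<noteq> a"
      using other[of c a] c by (auto simp: insert_commute)
    obtain y where y: "{d, y} \<in> z" "y \<noteq> d" "y \<noteq> b"
      using other[of d b] d by (auto simp: insert_commute)
    have "x \<noteq> d" "y \<noteq> c"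
      using x y no by (auto simp: insert_commute)
    then have "card {{a, b}, {a, c}, {b, d}, {c, x}, {d, y}} = 5"
      using ab c d cd x y by (auto simp: doubleton_eq_iff card_insert_if)
    then show ?thesis
      using five[of "{c, x}" "{d, y}"] ab c d x y by auto
  qed
qed

text \<open>Different triangles on a common edge \<open>pq\<close> have different third corners
  \<open>r\<close> and \<open>s\<close>, and then \<open>p\<close>, \<open>r\<close>,
  \<open>q\<close>, \<open>s\<close> is a 4-cycle.\<close>

lemma triangle_edges_disjoint:
  assumes "C4_free F" "S \<in> triangles F" "T \<in> triangles F" "S \<noteq> T"
  shows "S \<inter> T = {}"
proof (rule ccontr)
  assume "S \<inter> T \<noteq> {}"
  then obtain e where e: "e \<in> S" "e \<in> T" by blast
  \<comment> \<open>The corners are renamed so that the common edge comes first.\<close>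
  have apex: "\<exists>p q r. e = {p, q} \<and> distinct [p, q, r] \<and> R = {{p, q}, {q, r}, {p, r}}"
    if "R \<in> triangles F" "e \<in> R" for R
  proof -
    obtain a b c where R: "distinct [a, b, c]" "R = {{a, b}, {b, c}, {a, c}}"
      using \<open>R \<in> triangles F\<close> by (auto simp: triangles_def)
    then consider "e = {a, b}" | "e = {b, c}" | "e = {a, c}"
      using \<open>e \<in> R\<close> by blast
    then show ?thesis
    proof cases
      case 1
      then show ?thesis using R by blast
    next
      case 2
      then have "e = {b, c} \<and> distinct [b, c, a] \<and> R = {{b, c}, {c, a}, {b, a}}"
        using R by (auto simp: insert_commute)
      then show ?thesis by blast
    next
      case 3
      then have "e = {a, c} \<and> distinct [a, c, b] \<and> R = {{a, c}, {c, b}, {a, b}}"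
        using R by (auto simp: insert_commute)
      then show ?thesis by blast
    qed
  qed
  obtain p q r where S: "e = {p, q}" "distinct [p, q, r]" "S = {{p, q}, {q, r}, {p, r}}"
    using apex[OF assms(2) e(1)] by blast
  obtain p' q' s where T': "e = {p', q'}" "distinct [p', q', s]" "T = {{p', q'}, {q', s}, {p', s}}"
    using apex[OF assms(3) e(2)] by blast
  have T: "T = {{p, q}, {q, s}, {p, s}}" "distinct [p, q, s]"
    using S(1) T' by (auto simp: doubleton_eq_iff insert_commute)
  have "r \<noteq> s"
    using S(3) T(1) assms(4) by auto
  moreover have "{p, r} \<in> F" "{r, q} \<in> F" "{q, s} \<in> F" "{s, p} \<in> F"
    using assms(2,3) S(3) T(1) by (auto simp: triangles_def insert_commute)
  ultimately show False
    using assms(1)[unfolded C4_free_def, rule_format, of p r q s] S(2) T(2) by auto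
qed

section \<open>Signs of plane even edge sets\<close>

text \<open>Stated for an edge set rather than a digraph, so that the drawing is inherited by the
  edge sets left after deletions, with \<open>V\<close>, \<open>pos\<close> and
  \<open>\<gamma>\<close> unchanged.\<close>

locale drawing =
  fixes V :: "'a set" and E :: "'a set set" and pos :: "'a \<Rightarrow> complex"
    and \<gamma> :: "'a set \<Rightarrow> real \<Rightarrow> complex"
  assumes finite_edges: "finite E"
    and edge_card: "\<And>e. e \<in> E \<Longrightarrow> card e = 2"
    and edge_verts: "\<And>e. e \<in> E \<Longrightarrow> e \<subseteq> V"
    and pos_inj: "inj_on pos V"
    and arc_edge: "\<And>e. e \<in> E \<Longrightarrow> arc (\<gamma> e)"
    and ends_edge: "\<And>e. e \<in> E \<Longrightarrow> {pathstart (\<gamma> e), pathfinish (\<gamma> e)} = pos ` e"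
    and edge_meets_verts: "\<And>e. e \<in> E \<Longrightarrow> path_image (\<gamma> e) \<inter> pos ` V = pos ` e"
    and edges_meet: "\<And>e e'. e \<in> E \<Longrightarrow> e' \<in> E \<Longrightarrow> e \<noteq> e' \<Longrightarrow>
      path_image (\<gamma> e) \<inter> path_image (\<gamma> e') \<subseteq> pos ` (e \<inter> e')"
begin

definition img :: "'a set set \<Rightarrow> complex set" where
  "img F = (\<Union>e\<in>F. path_image (\<gamma> e))"

text \<open>The vertices are included because the face count starts with the single vertex
  \<open>r\<close> and no edge.\<close>

definition pic :: "'a set \<Rightarrow> 'a set set \<Rightarrow> complex set" where
  "pic W F = pos ` W \<union> img F"

text \<open>Continuing a square root of \<open>\<gamma> e - p\<close> along the edge from the principal root at its start leads to
  the principal root at its end, up to this sign. In the product over an edge set with even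
  degrees the choice of the roots cancels; over a closed curve the product is \<open>-1\<close> to the
  power of the winding number around \<open>p\<close>.\<close>

definition edge_sign :: "'a set \<Rightarrow> complex \<Rightarrow> complex" where
  "edge_sign e p = exp (pi * \<i> * winding_number (\<gamma> e) p) *
     csqrt (pathstart (\<gamma> e) - p) / csqrt (pathfinish (\<gamma> e) - p)"

definition parity_sign :: "'a set set \<Rightarrow> complex \<Rightarrow> complex" where
  "parity_sign z p = (\<Prod>e\<in>z. edge_sign e p)"

lemma path_edge: "e \<in> E \<Longrightarrow> path (\<gamma> e)"
  by (simp add: arc_edge arc_imp_path)

lemma edge_neq: "{u, w} \<in> E \<Longrightarrow> u \<noteq> w"
  using edge_card by fastforce

lemma compact_img: "F \<subseteq> E \<Longrightarrow> compact (img F)"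
  unfolding img_def using finite_edges
  by (intro compact_UN) (auto intro: finite_subset compact_path_image path_edge)

text \<open>For the winding number n of the arc, exp (2 pi i n) is the quotient of its two ends as
  seen from \<open>p\<close>; in the square of the sign the squared roots cancel this
  quotient.\<close>

lemma edge_sign_cases:
  assumes "e \<in> E" "p \<notin> path_image (\<gamma> e)"
  shows "edge_sign e p = 1 \<or> edge_sign e p = -1"
proof -
  have "exp (2 * pi * \<i> * winding_number (\<gamma> e) p) * (pathstart (\<gamma> e) - p) = pathfinish (\<gamma> e) - p"
    using winding_number_exp_2pi[OF path_edge] assms by simp
  moreover have "exp (2 * pi * \<i> * winding_number (\<gamma> e) p) = (exp (pi * \<i> * winding_number (\<gamma> e) p))\<^sup>2"
    by (simp add: exp_double[symmetric] mult.assoc)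
  moreover have "pathfinish (\<gamma> e) - p \<noteq> 0"
    using assms(2) by auto
  ultimately have "(edge_sign e p)\<^sup>2 = 1"
    by (simp add: edge_sign_def power_mult_distrib power_divide)
  then show ?thesis
    by (simp add: power2_eq_1_iff)
qed

text \<open>The drawn arc of an edge may run either way. Reversal inverts the exponential and swaps
  the roots, so the sign is inverted, that is, unchanged. The equation avoids division so that along
  a path the roots at inner vertices disappear by substitution.\<close>

lemma oriented_edge:
  assumes "{v, w} \<in> E"
  obtains a where "arc a" "pathstart a = pos v" "pathfinish a = pos w"
    "path_image a = path_image (\<gamma> {v, w})"
    "\<And>p. p \<notin> path_image (\<gamma> {v, w}) \<Longrightarrow>
       exp (pi * \<i> * winding_number a p) * csqrt (pos v - p) = edge_sign {v, w} p * csqrt (pos w - p)"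
proof -
  let ?g = "\<gamma> {v, w}"
  have g: "arc ?g" "path ?g"
    using assms arc_edge path_edge by auto
  have "{pathstart ?g, pathfinish ?g} = {pos v, pos w}"
    using ends_edge[OF assms] by auto
  then consider "pathstart ?g = pos v" "pathfinish ?g = pos w"
    | "pathstart ?g = pos w" "pathfinish ?g = pos v"
    by (auto simp: doubleton_eq_iff)
  then show ?thesis
  proof cases
    case 1
    show ?thesis
    proof (rule that[of ?g])
      fix p assume "p \<notin> path_image ?g"
      then have "pos w - p \<noteq> 0"
        using 1 by (metis eq_iff_diff_eq_0 pathfinish_in_path_image)
      then show "exp (pi * \<i> * winding_number ?g p) * csqrt (pos v - p) = edge_sign {v, w} p * csqrt (pos w - p)"
        by (simp add: edge_sign_def 1)
    qed (use g 1 in auto)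
  next
    case 2
    show ?thesis
    proof (rule that[of "reversepath ?g"])
      fix p assume p: "p \<notin> path_image ?g"
      then have nz: "pos v - p \<noteq> 0"
        using 2 by (metis eq_iff_diff_eq_0 pathfinish_in_path_image)
      define X where "X = exp (pi * \<i> * winding_number ?g p)"
      have "exp (2 * pi * \<i> * winding_number ?g p) = X\<^sup>2"
        by (simp add: X_def exp_double[symmetric] mult.assoc)
      then have sq: "(csqrt (pos v - p))\<^sup>2 = X\<^sup>2 * (csqrt (pos w - p))\<^sup>2"
        using winding_number_exp_2pi[OF g(2) p] 2 by simp
      have "exp (pi * \<i> * winding_number (reversepath ?g) p) = inverse X"
        by (simp add: winding_number_reversepath[OF g(2) p] X_def exp_minus)
      moreover have "inverse X * csqrt (pos v - p) = X * csqrt (pos w - p) / csqrt (pos v - p) * csqrt (pos w - p)"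
        using sq nz by (simp add: X_def field_simps power2_eq_square)
      ultimately show "exp (pi * \<i> * winding_number (reversepath ?g) p) * csqrt (pos v - p)
          = edge_sign {v, w} p * csqrt (pos w - p)"
        by (simp add: edge_sign_def 2 X_def)
    qed (use g 2 in \<open>auto simp: arc_reversepath\<close>)
  qed
qed

text \<open>The edge equations telescope: the root at the old end \<open>v\<close> is traded for the
  one at \<open>w\<close>, and the signs multiply. As \<open>w\<close> is new, the next edge meets
  the drawn path only at \<open>v\<close>, so the join is again an arc.\<close>

lemma walk_arc:
  assumes "simple_walk F u W P v" "F \<subseteq> E" "u \<noteq> v"
  shows "\<exists>a. arc a \<and> pathstart a = pos u \<and> pathfinish a = pos v \<and> path_image a = img P \<and>
    (\<forall>p. p \<notin> img P \<longrightarrow>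
       exp (pi * \<i> * winding_number a p) * csqrt (pos u - p) = parity_sign P p * csqrt (pos v - p))"
  using assms(1,3)
proof (induction)
  case start
  then show ?case by simp
next
  case (step W P v w)
  note f = simple_walk_facts[OF step.hyps(1)]
  have vw: "{v, w} \<in> E" "{v, w} \<notin> P"
    using step.hyps(2,3) assms(2) f(3) by auto
  obtain b where b: "arc b" "pathstart b = pos v" "pathfinish b = pos w"
    "path_image b = path_image (\<gamma> {v, w})"
    "\<And>p. p \<notin> path_image (\<gamma> {v, w}) \<Longrightarrow>
       exp (pi * \<i> * winding_number b p) * csqrt (pos v - p) = edge_sign {v, w} p * csqrt (pos w - p)"
    using oriented_edge[OF vw(1)] by blast
  show ?case
  proof (cases "u = v")
    case True
    \<comment> \<open>A last step to \<open>u\<close> would enter a vertex already visited, so the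
      walk has no steps.\<close>
    then have "P = {}"
      using step.hyps(1) by (auto elim!: simple_walk.cases[of _ _ _ _ v] dest: simple_walk_facts(4))
    then show ?thesis
      using True b by (intro exI[of _ b]) (auto simp: img_def parity_sign_def)
  next
    case False
    then obtain a where a: "arc a" "pathstart a = pos u" "pathfinish a = pos v" "path_image a = img P"
      "\<And>p. p \<notin> img P \<Longrightarrow>
         exp (pi * \<i> * winding_number a p) * csqrt (pos u - p) = parity_sign P p * csqrt (pos v - p)"
      using step.IH by blast
    have "path_image (\<gamma> f) \<inter> path_image (\<gamma> {v, w}) \<subseteq> {pos v}" if "f \<in> P" for f
    proof -
      have "f \<in> E" "f \<inter> {v, w} \<subseteq> {v}" "f \<noteq> {v, w}"
        using that f(2,3) assms(2) step.hyps(3) vw(2) by auto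
      then show ?thesis
        using edges_meet[OF _ vw(1), of f] by blast
    qed
    then have "path_image a \<inter> path_image b \<subseteq> {pathstart b}"
      unfolding a(4) b(2,4) img_def by blast
    then have "arc (a +++ b)"
      using a b by (intro arc_join) auto
    moreover have "path_image (a +++ b) = img (insert {v, w} P)"
      using a b by (simp add: path_image_join img_def Un_commute)
    moreover have "exp (pi * \<i> * winding_number (a +++ b) p) * csqrt (pos u - p)
        = parity_sign (insert {v, w} P) p * csqrt (pos w - p)" if "p \<notin> img (insert {v, w} P)" for p
    proof -
      have p: "p \<notin> img P" "p \<notin> path_image (\<gamma> {v, w})"
        using that by (auto simp: img_def)
      have "winding_number (a +++ b) p = winding_number a p + winding_number b p"
        using a b p by (intro winding_number_join) (auto simp: arc_imp_path)
      then have "exp (pi * \<i> * winding_number (a +++ b) p) * csqrt (pos u - p)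
        = exp (pi * \<i> * winding_number b p) * (exp (pi * \<i> * winding_number a p) * csqrt (pos u - p))"
        by (simp add: distrib_left exp_add)
      also have "\<dots> = parity_sign P p * (exp (pi * \<i> * winding_number b p) * csqrt (pos v - p))"
        using a(5)[OF p(1)] by simp
      also have "\<dots> = parity_sign (insert {v, w} P) p * csqrt (pos w - p)"
        using b(5)[OF p(2)] f(1) vw(2) by (simp add: parity_sign_def)
      finally show ?thesis .
    qed
    ultimately show ?thesis
      using a b by (intro exI[of _ "a +++ b"]) auto
  qed
qed

text \<open>On a loop the two end roots coincide and cancel, so the sign is exp (pi i n) for the
  winding number n, which is 1 or -1 inside a simple loop and 0 outside. The conclusions about
  \<open>img P\<close> serve Janiszewski's theorem in the chord step of
  \<open>card_faces\<close>.\<close>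

lemma walk_loop:
  assumes "simple_walk F u W P w" "F \<subseteq> E" "{u, w} \<in> E" "{u, w} \<notin> P"
  obtains C where "simple_path C" "pathfinish C = pathstart C" "path_image C = img (insert {u, w} P)"
    "\<And>p. p \<in> inside (path_image C) \<Longrightarrow> parity_sign (insert {u, w} P) p = -1"
    "\<And>p. p \<in> outside (path_image C) \<Longrightarrow> parity_sign (insert {u, w} P) p = 1"
    "connected (img P)" "pos u \<in> img P" "pos w \<in> img P"
proof -
  let ?e = "{u, w}"
  have "u \<noteq> w" using edge_neq assms(3) by blast
  then obtain a where a: "arc a" "pathstart a = pos u" "pathfinish a = pos w" "path_image a = img P"
    "\<And>p. p \<notin> img P \<Longrightarrow>
       exp (pi * \<i> * winding_number a p) * csqrt (pos u - p) = parity_sign P p * csqrt (pos w - p)"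
    using walk_arc[OF assms(1,2)] by blast
  have wu: "{w, u} = ?e" by auto
  obtain b where b: "arc b" "pathstart b = pos w" "pathfinish b = pos u"
    "path_image b = path_image (\<gamma> ?e)"
    "\<And>p. p \<notin> path_image (\<gamma> ?e) \<Longrightarrow>
       exp (pi * \<i> * winding_number b p) * csqrt (pos w - p) = edge_sign ?e p * csqrt (pos u - p)"
    using oriented_edge[of w u] assms(3) unfolding wu by metis
  note f = simple_walk_facts[OF assms(1)]
  have "path_image (\<gamma> f) \<inter> path_image (\<gamma> ?e) \<subseteq> {pos u, pos w}" if "f \<in> P" for f
  proof -
    have "f \<in> E" "f \<noteq> ?e"
      using that f(2) assms(2,4) by auto
    then show ?thesis
      using edges_meet[OF _ assms(3), of f] by blast
  qed
  then have meet: "img P \<inter> path_image (\<gamma> ?e) \<subseteq> {pos u, pos w}"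
    unfolding img_def by blast
  define C where "C = a +++ b"
  have C: "simple_path C" "pathfinish C = pathstart C"
    unfolding C_def using a b meet by (auto intro!: simple_path_join_loop)
  have imgC: "path_image C = img (insert ?e P)"
    unfolding C_def using a b by (simp add: path_image_join img_def Un_commute)
  have key: "exp (pi * \<i> * winding_number C p) = parity_sign (insert ?e P) p" if "p \<notin> path_image C" for p
  proof -
    have p: "p \<notin> img P" "p \<notin> path_image (\<gamma> ?e)"
      using that by (auto simp: imgC img_def)
    have "winding_number C p = winding_number a p + winding_number b p"
      unfolding C_def using a b p by (intro winding_number_join) (auto simp: arc_imp_path)
    then have "exp (pi * \<i> * winding_number C p) * csqrt (pos u - p)
        = exp (pi * \<i> * winding_number b p) * (exp (pi * \<i> * winding_number a p) * csqrt (pos u - p))"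
      by (simp add: distrib_left exp_add)
    also have "\<dots> = parity_sign P p * (exp (pi * \<i> * winding_number b p) * csqrt (pos w - p))"
      using a(5)[OF p(1)] by simp
    also have "\<dots> = parity_sign (insert ?e P) p * csqrt (pos u - p)"
      using b(5)[OF p(2)] f(1) assms(4) by (simp add: parity_sign_def)
    moreover have "pos u - p \<noteq> 0"
      using a p by (metis eq_iff_diff_eq_0 pathstart_in_path_image)
    ultimately show ?thesis by simp
  qed
  show ?thesis
  proof (rule that[OF C imgC])
    fix p assume p: "p \<in> inside (path_image C)"
    then have "p \<notin> path_image C"
      using inside_no_overlap by blast
    moreover have "winding_number C p = 1 \<or> winding_number C p = -1"
      using simple_closed_path_winding_number_inside[OF C(1)] p by metis
    then have "exp (pi * \<i> * winding_number C p) = -1"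
      by (auto simp: exp_minus)
    ultimately show "parity_sign (insert ?e P) p = -1"
      using key by simp
  next
    fix p assume p: "p \<in> outside (path_image C)"
    then have "p \<notin> path_image C"
      using outside_no_overlap by blast
    moreover have "winding_number C p = 0"
      using winding_number_zero_in_outside C p by (simp add: simple_path_imp_path)
    ultimately show "parity_sign (insert ?e P) p = 1"
      using key[of p] by simp
  next
    show "connected (img P)"
      using a(1,4) connected_arc_image by metis
    show "pos u \<in> img P" "pos w \<in> img P"
      using a by (metis pathstart_in_path_image pathfinish_in_path_image)+
  qed
qed

text \<open>Common edges contribute the square of a sign. This makes the inside modulo 2
  additive.\<close>

lemma sign_sym_diff:
  assumes "finite y" "finite z" "y \<union> z \<subseteq> E" "p \<notin> img (y \<union> z)"
  shows "parity_sign (sym_diff y z) p = parity_sign y p * parity_sign z p"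
proof -
  have one: "edge_sign e p * edge_sign e p = 1" if "e \<in> y \<union> z" for e
  proof -
    have "e \<in> E" "p \<notin> path_image (\<gamma> e)"
      using assms(3,4) that by (auto simp: img_def)
    then show ?thesis
      using edge_sign_cases by fastforce
  qed
  have "parity_sign y p = parity_sign (y - z) p * parity_sign (y \<inter> z) p" "parity_sign z p = parity_sign (z - y) p * parity_sign (y \<inter> z) p"
    using assms(1,2) unfolding parity_sign_def
    by (subst prod.union_disjoint[symmetric]; auto intro: prod.cong)+
  moreover have "parity_sign (y \<inter> z) p * parity_sign (y \<inter> z) p = 1"
    unfolding parity_sign_def prod.distrib[symmetric] using one by (intro prod.neutral) auto
  moreover have "parity_sign (sym_diff y z) p = parity_sign (y - z) p * parity_sign (z - y) p"
    using assms(1,2) unfolding parity_sign_def by (intro prod.union_disjoint) auto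
  ultimately show ?thesis
    by (metis mult.assoc mult.commute mult.right_neutral)
qed

lemma sign_cases:
  assumes "z \<subseteq> E" "p \<notin> img z"
  shows "parity_sign z p = 1 \<or> parity_sign z p = -1"
proof -
  have "finite z" using assms(1) finite_edges by (rule finite_subset)
  then show ?thesis
    using assms
  proof (induction z)
    case empty
    then show ?case by (simp add: parity_sign_def)
  next
    case (insert e z)
    then show ?case
      using edge_sign_cases[of e p] by (auto simp: parity_sign_def img_def)
  qed
qed

text \<open>A multiplicative handshake lemma. Both ends enter symmetrically, so the direction of the
  arcs does not matter.\<close>

lemma prod_ends:
  fixes g :: "complex \<Rightarrow> complex"
  assumes "z \<subseteq> E"
  shows "(\<Prod>e\<in>z. g (pathstart (\<gamma> e)) * g (pathfinish (\<gamma> e))) = (\<Prod>v\<in>\<Union>z. g (pos v) ^ deg z v)"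
proof -
  have fin: "finite z" using assms finite_edges by (rule finite_subset)
  have fine: "finite e" if "e \<in> z" for e
    using edge_card assms that by (metis card.infinite subsetD zero_neq_numeral)
  then have finU: "finite (\<Union>z)"
    using fin by auto
  have "g (pathstart (\<gamma> e)) * g (pathfinish (\<gamma> e)) = (\<Prod>v\<in>\<Union>z. if v \<in> e then g (pos v) else 1)"
    if e: "e \<in> z" for e
  proof -
    obtain v w where vw: "e = {v, w}" "v \<noteq> w"
      using edge_card assms e by (metis card_2_iff subsetD)
    have "{pathstart (\<gamma> e), pathfinish (\<gamma> e)} = {pos v, pos w}"
      using ends_edge[of e] assms e vw by auto
    then have "g (pathstart (\<gamma> e)) * g (pathfinish (\<gamma> e)) = g (pos v) * g (pos w)"
      by (auto simp: doubleton_eq_iff)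
    also have "\<dots> = (\<Prod>v\<in>e. g (pos v))"
      using vw by simp
    also have "\<dots> = (\<Prod>v\<in>\<Union>z. if v \<in> e then g (pos v) else 1)"
      using finU e by (intro prod.mono_neutral_cong_left) auto
    finally show ?thesis .
  qed
  then have "(\<Prod>e\<in>z. g (pathstart (\<gamma> e)) * g (pathfinish (\<gamma> e)))
      = (\<Prod>e\<in>z. \<Prod>v\<in>\<Union>z. if v \<in> e then g (pos v) else 1)"
    by (intro prod.cong) auto
  also have "\<dots> = (\<Prod>v\<in>\<Union>z. \<Prod>e\<in>z. if v \<in> e then g (pos v) else 1)"
    by (rule prod.swap)
  also have "\<dots> = (\<Prod>v\<in>\<Union>z. g (pos v) ^ deg z v)"
    using fin by (intro prod.cong) (auto simp: prod.If_cases deg_def Int_def)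
  finally show ?thesis .
qed

text \<open>Away from the drawn edges the sign equals a continuous expression \<open>h\<close>, and
  a continuous function with values in \<open>{1, -1}\<close> is constant on a connected
  set.\<close>

lemma sign_constant:
  assumes "z \<in> even_sets E" "connected S" "S \<inter> img z = {}" "p \<in> S" "q \<in> S"
  shows "parity_sign z p = parity_sign z q"
proof -
  have z: "z \<subseteq> E" "\<And>v. even (deg z v)"
    using assms(1) by (auto simp: even_sets_def)
  have fin: "finite z" using z(1) finite_edges by (rule finite_subset)
  have out: "x \<notin> path_image (\<gamma> e)" if "x \<in> S" "e \<in> z" for x e
    using assms(3) that by (auto simp: img_def)
  then have nz: "pathfinish (\<gamma> e) - x \<noteq> 0" if "x \<in> S" "e \<in> z" for x e
    using that by (metis eq_iff_diff_eq_0 pathfinish_in_path_image)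
  define h where "h x = (\<Prod>e\<in>z. exp (pi * \<i> * winding_number (\<gamma> e) x)) *
     (\<Prod>v\<in>\<Union>z. (pos v - x) ^ (deg z v div 2)) / (\<Prod>e\<in>z. pathfinish (\<gamma> e) - x)" for x
  \<comment> \<open>As all degrees are even, the discontinuous principal roots occur in even powers only.\<close>
  have sh: "parity_sign z x = h x" if x: "x \<in> S" for x
  proof -
    let ?s = "\<lambda>y. csqrt (y - x)"
    \<comment> \<open>Expanding by the root at \<open>pathfinish\<close> makes the numerator
      symmetric in the two ends and frees the denominator from roots.\<close>
    have "parity_sign z x = (\<Prod>e\<in>z. exp (pi * \<i> * winding_number (\<gamma> e) x) *
        (?s (pathstart (\<gamma> e)) * ?s (pathfinish (\<gamma> e))) / (pathfinish (\<gamma> e) - x))"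
      unfolding parity_sign_def
    proof (intro prod.cong refl)
      fix e assume "e \<in> z"
      have "(?s (pathfinish (\<gamma> e)))\<^sup>2 = pathfinish (\<gamma> e) - x" "?s (pathfinish (\<gamma> e)) \<noteq> 0"
        using nz[OF x \<open>e \<in> z\<close>] by simp_all
      then show "edge_sign e x = exp (pi * \<i> * winding_number (\<gamma> e) x) *
        (?s (pathstart (\<gamma> e)) * ?s (pathfinish (\<gamma> e))) / (pathfinish (\<gamma> e) - x)"
        unfolding edge_sign_def by (metis (no_types, lifting) mult.assoc nonzero_mult_divide_mult_cancel_right power2_eq_square)
    qed
    also have "\<dots> = (\<Prod>e\<in>z. exp (pi * \<i> * winding_number (\<gamma> e) x)) *
        (\<Prod>v\<in>\<Union>z. ?s (pos v) ^ deg z v) / (\<Prod>e\<in>z. pathfinish (\<gamma> e) - x)"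
      unfolding prod_dividef prod.distrib prod_ends[OF z(1), of ?s, symmetric] ..
    also have "(\<Prod>v\<in>\<Union>z. ?s (pos v) ^ deg z v) = (\<Prod>v\<in>\<Union>z. (pos v - x) ^ (deg z v div 2))"
    proof (intro prod.cong refl)
      fix v
      have "?s (pos v) ^ deg z v = (?s (pos v))\<^sup>2 ^ (deg z v div 2)"
        unfolding power_mult[symmetric] using z(2) by simp
      then show "?s (pos v) ^ deg z v = (pos v - x) ^ (deg z v div 2)"
        by simp
    qed
    finally show ?thesis
      by (simp add: h_def)
  qed
  have "continuous_on S (\<lambda>x. winding_number (\<gamma> e) x)" if "e \<in> z" for e
    using continuous_on_winding_number[OF path_edge] z(1) out that
    by (meson ComplI continuous_on_subset subsetD subsetI)
  then have "continuous_on S h"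
    unfolding h_def using nz fin by (intro continuous_intros) auto
  moreover have "finite (h ` S)"
  proof (rule finite_subset)
    show "h ` S \<subseteq> {1, -1}"
      using sh sign_cases[OF z(1)] assms(3) by (metis IntI empty_iff image_subsetI insertI1 insertI2)
  qed auto
  ultimately have "h constant_on S"
    using continuous_finite_range_constant assms(2) by blast
  then show ?thesis
    using sh assms(4,5) unfolding constant_on_def by metis
qed

end

section \<open>Faces and the edge bound\<close>

lemma components_connected: "connected S \<Longrightarrow> components S \<subseteq> {S}"
  by (metis components_eq_empty components_eq_sing_iff empty_subsetI order_refl)

text \<open>Sending a component of \<open>U'\<close> to the component of \<open>U\<close> around one
  of its points is injective, as points connected in \<open>U\<close> stay connected in
  \<open>U'\<close>.\<close>

lemma card_components_if_not_separating:
  fixes U U' :: "'a::topological_space set"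
  assumes "U' \<subseteq> U" "finite (components U)"
    and "\<And>x y. x \<in> U' \<Longrightarrow> y \<in> U' \<Longrightarrow> connected_component U x y \<Longrightarrow> connected_component U' x y"
  shows "finite (components U') \<and> card (components U') \<le> card (components U)"
proof -
  define \<phi> where "\<phi> T = connected_component_set U (SOME x. x \<in> T)" for T
  have rep: "(SOME x. x \<in> T) \<in> T" if "T \<in> components U'" for T
    using in_components_nonempty[OF that] by (simp add: some_in_eq)
  have eq: "T = connected_component_set U' (SOME x. x \<in> T)" if "T \<in> components U'" for T
    using that rep[OF that] by (metis components_iff connected_component_eq)
  have inj: "inj_on \<phi> (components U')"
  proof (rule inj_onI)
    fix S T assume S: "S \<in> components U'" and T: "T \<in> components U'" and \<phi>: "\<phi> S = \<phi> T"
    let ?x = "SOME x. x \<in> S" and ?y = "SOME x. x \<in> T"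
    have x: "?x \<in> U'" "?y \<in> U'"
      using rep S T in_components_subset by blast+
    have "connected_component U ?x ?y"
      using \<phi> x assms(1) unfolding \<phi>_def by (metis connected_component_eq_eq subsetD)
    then have "connected_component U' ?x ?y"
      using assms(3) x by blast
    then show "S = T"
      using eq[OF S] eq[OF T] connected_component_eq_eq[of U' ?x ?y] x by metis
  qed
  moreover have "\<phi> ` components U' \<subseteq> components U"
  proof (rule image_subsetI)
    fix T assume T: "T \<in> components U'"
    then have "(SOME x. x \<in> T) \<in> U"
      using rep[OF T] in_components_subset[OF T] assms(1) by blast
    then show "\<phi> T \<in> components U"
      unfolding \<phi>_def by (rule componentsI)
  qed
  ultimately show ?thesis
    using assms(2) by (metis card_inj_on_le inj_on_finite)
qed

text \<open>Components other than \<open>R\<close> do not meet \<open>A\<close> and survive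
  unchanged. Within \<open>R\<close> a new component is determined by the value of
  \<open>side\<close> at one of its points, so there are at most two.\<close>

lemma card_components_split_one:
  fixes K A :: "'a::topological_space set" and side :: "'a \<Rightarrow> bool"
  assumes "finite (components (- K))" "R \<in> components (- K)" "A - K \<subseteq> R"
    and same: "\<And>x y. x \<notin> K \<union> A \<Longrightarrow> y \<notin> K \<union> A \<Longrightarrow> connected_component (- K) x y \<Longrightarrow> side x = side y
      \<Longrightarrow> connected_component (- (K \<union> A)) x y"
  shows "finite (components (- (K \<union> A))) \<and> card (components (- (K \<union> A))) \<le> card (components (- K)) + 1"
proof -
  let ?N = "{T \<in> components (- (K \<union> A)). T \<subseteq> R}"
  define \<sigma> where "\<sigma> T = side (SOME x. x \<in> T)" for T
  have inj: "inj_on \<sigma> ?N"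
  proof (rule inj_onI)
    fix S T assume S: "S \<in> ?N" and T: "T \<in> ?N" and \<sigma>: "\<sigma> S = \<sigma> T"
    have x: "(SOME x. x \<in> S) \<in> S" "(SOME x. x \<in> T) \<in> T"
      using S T in_components_nonempty by (auto simp: some_in_eq)
    then have "connected_component (- K) (SOME x. x \<in> S) (SOME x. x \<in> T)"
      using S T assms(2) in_components_connected[OF assms(2)] in_components_subset[OF assms(2)]
      by (blast intro: connected_component_of_subset connected_componentI)
    moreover have "(SOME x. x \<in> S) \<notin> K \<union> A" "(SOME x. x \<in> T) \<notin> K \<union> A"
      using x S T in_components_subset by blast+
    ultimately have "connected_component (- (K \<union> A)) (SOME x. x \<in> S) (SOME x. x \<in> T)"
      using same \<sigma> unfolding \<sigma>_def by blast
    then show "S = T"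
      using S T x by (metis (no_types, lifting) components_iff connected_component_eq mem_Collect_eq)
  qed
  have "finite ?N" "card ?N \<le> 2"
    using inj card_inj_on_le[OF inj, of UNIV] inj_on_finite[OF inj, of UNIV] by (auto simp: card_UNIV_bool)
  moreover have "components (- (K \<union> A)) \<subseteq> (components (- K) - {R}) \<union> ?N"
  proof
    fix T assume T: "T \<in> components (- (K \<union> A))"
    then have "connected T" "T \<subseteq> - K" "T \<noteq> {}"
      using in_components_connected in_components_subset in_components_nonempty by blast+
    then obtain S where S: "S \<in> components (- K)" "T \<subseteq> S"
      using exists_component_superset[of T "- K"] by blast
    show "T \<in> (components (- K) - {R}) \<union> ?N"
    proof (cases "S = R")
      case True
      then show ?thesis using S T by blast
    next
      case False
      then have "S \<inter> R = {}"
        using components_nonoverlap S assms(2) by metis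
      then have "S \<subseteq> - (K \<union> A)"
        using in_components_subset[OF S(1)] assms(3) by blast
      then have "S \<subseteq> T"
        using components_maximal[OF T in_components_connected[OF S(1)]] S(2) \<open>T \<noteq> {}\<close> by blast
      then have "T = S"
        using S(2) by (rule equalityI[rotated])
      then show ?thesis
        using S(1) False by simp
    qed
  qed
  moreover have "finite (components (- K) - {R})"
    using assms(1) by simp
  ultimately have "finite (components (- (K \<union> A)))"
    and "card (components (- (K \<union> A))) \<le> card ((components (- K) - {R}) \<union> ?N)"
    by (meson finite_Un finite_subset, meson finite_Un card_mono)
  moreover have "card ((components (- K) - {R}) \<union> ?N) \<le> card (components (- K) - {R}) + card ?N"
    by (rule card_Un_le)
  moreover have "card (components (- K)) = Suc (card (components (- K) - {R}))"
    using assms(1,2) by (rule card.remove)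
  ultimately show ?thesis
    using \<open>card ?N \<le> 2\<close> by linarith
qed

context drawing
begin

section \<open>Faces of connected plane graphs and Euler's formula\<close>

lemma img_mono: "F \<subseteq> F' \<Longrightarrow> img F \<subseteq> img F'"
  by (auto simp: img_def)

lemma compact_pic: "finite W \<Longrightarrow> F \<subseteq> E \<Longrightarrow> compact (pic W F)"
  unfolding pic_def by (intro compact_Un compact_img finite_imp_compact) auto

lemma grown_verts: "grown E r W F \<Longrightarrow> r \<in> V \<Longrightarrow> W \<subseteq> V"
  by (induction rule: grown.induct) (use edge_verts in auto)

lemma edge_Int_pic:
  assumes "e \<in> E" "e \<notin> F" "F \<subseteq> E" "\<Union>F \<subseteq> W" "W \<subseteq> V"
  shows "path_image (\<gamma> e) \<inter> pic W F = pos ` (e \<inter> W)"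
proof -
  have sub: "pos ` e \<subseteq> path_image (\<gamma> e)"
    using edge_meets_verts[OF assms(1)] by blast
  have "path_image (\<gamma> e) \<inter> pos ` W \<subseteq> pos ` (e \<inter> W)"
  proof
    fix x assume "x \<in> path_image (\<gamma> e) \<inter> pos ` W"
    then obtain v where v: "v \<in> W" "x = pos v" "pos v \<in> pos ` e"
      using edge_meets_verts[OF assms(1)] assms(5) by blast
    then have "v \<in> e"
      using edge_verts[OF assms(1)] assms(5) pos_inj by (meson inj_on_image_mem_iff subsetD)
    then show "x \<in> pos ` (e \<inter> W)" using v by blast
  qed
  moreover have "path_image (\<gamma> e) \<inter> path_image (\<gamma> f) \<subseteq> pos ` (e \<inter> W)" if "f \<in> F" for f
    using edges_meet[of e f] that assms by blast
  then have "path_image (\<gamma> e) \<inter> img F \<subseteq> pos ` (e \<inter> W)"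
    unfolding img_def by blast
  ultimately show ?thesis
    using sub unfolding pic_def by blast
qed

text \<open>\<open>W'\<close> is \<open>insert w W\<close> for a pendant edge and \<open>W\<close>
  for a chord.\<close>

lemma pic_insert:
  assumes "e \<in> E" "e \<subseteq> W'" "W' \<subseteq> W \<union> e"  "W \<subseteq> W'"
  shows "pic W' (insert e F) = pic W F \<union> path_image (\<gamma> e)"
proof -
  have "pos ` W' = pos ` W \<union> pos ` e"
    using assms(2-4) by blast
  moreover have "pos ` e \<subseteq> path_image (\<gamma> e)"
    using edge_meets_verts[OF assms(1)] by blast
  ultimately show ?thesis
    unfolding pic_def img_def by auto
qed

text \<open>A pendant edge meets the picture in one point, so by Janiszewski's theorem it separates
  no two points of a face. A chord meets it in two points, where the theorem does not apply; but the
  loop formed by the chord and a path of \<open>F\<close> meets the picture exactly in the connected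
  path. As the loop has two sides, a chord cuts one face into at most two.\<close>

lemma card_faces:
  assumes "grown E r W F" "r \<in> V"
  shows "finite (components (- pic W F)) \<and> card (components (- pic W F)) + card W \<le> card F + 2"
  using assms(1)
proof (induction)
  case root
  have "components (- {pos r}) \<subseteq> {- {pos r}}"
    by (intro components_connected connected_punctured_universe) simp
  then have "finite (components (- {pos r}))" "card (components (- {pos r})) \<le> 1"
    using finite_subset card_mono[of "{- {pos r}}"] by fastforce+
  then show ?case
    by (simp add: pic_def img_def)
next
  case (pendant W F u w)
  note f = grown_facts[OF pendant.hyps(1)]
  let ?e = "{u, w}"
  have e: "?e \<notin> F"
    using f(4) pendant.hyps(3) by auto
  have W: "W \<subseteq> V"
    using grown_verts pendant.hyps(1) assms(2) by blast
  have pic: "pic (insert w W) (insert ?e F) = pic W F \<union> path_image (\<gamma> ?e)"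
    by (rule pic_insert) (use pendant.hyps in auto)
  have "connected_component (- (pic W F \<union> path_image (\<gamma> ?e))) x y"
    if "x \<notin> pic W F \<union> path_image (\<gamma> ?e)" "y \<notin> pic W F \<union> path_image (\<gamma> ?e)"
      "connected_component (- pic W F) x y" for x y
  proof (rule Janiszewski)
    have "pic W F \<inter> path_image (\<gamma> ?e) = {pos u}"
      using edge_Int_pic[OF pendant.hyps(4) e f(3,4) W] pendant.hyps(2,3) by (auto simp: Int_commute)
    then show "connected (pic W F \<inter> path_image (\<gamma> ?e))"
      by simp
    show "compact (pic W F)"
      using compact_pic f by blast
    show "closed (path_image (\<gamma> ?e))"
      using path_edge pendant.hyps(4) by (blast intro: closed_path_image)
    have "connected (- path_image (\<gamma> ?e))"
      by (rule connected_arc_complement) (use arc_edge pendant.hyps(4) in auto)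
    then show "connected_component (- path_image (\<gamma> ?e)) x y"
      using that by (simp add: connected_iff_connected_component)
  qed (rule that)
  then have "finite (components (- (pic W F \<union> path_image (\<gamma> ?e)))) \<and>
     card (components (- (pic W F \<union> path_image (\<gamma> ?e)))) \<le> card (components (- pic W F))"
    using pendant.IH by (intro card_components_if_not_separating) auto
  then show ?case
    using pendant.IH f e pendant.hyps(3) by (simp add: pic)
next
  case (chord W F u w)
  note f = grown_facts[OF chord.hyps(1)]
  let ?e = "{u, w}" and ?K = "pic W F" and ?A = "path_image (\<gamma> {u, w})"
  have W: "W \<subseteq> V"
    using grown_verts chord.hyps(1) assms(2) by blast
  obtain X P where P: "simple_walk F u X P w"
    using ex_simple_walk grown_connected[OF chord.hyps(1-3)] by metis
  have PF: "P \<subseteq> F" "?e \<notin> P"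
    using simple_walk_facts(2)[OF P] chord.hyps(5) by auto
  obtain C where C: "simple_path C" "pathfinish C = pathstart C" "path_image C = img (insert ?e P)"
    "connected (img P)" "pos u \<in> img P" "pos w \<in> img P"
    using walk_loop[OF P f(3) chord.hyps(4) PF(2)] by metis
  have int: "?K \<inter> ?A = {pos u, pos w}"
    using edge_Int_pic[OF chord.hyps(4,5) f(3,4) W] chord.hyps(2,3) by auto
  have imgC: "path_image C = img P \<union> ?A"
    using C(3) by (simp add: img_def Un_commute)
  have imgP: "img P \<subseteq> ?K"
    using img_mono[OF PF(1)] by (auto simp: pic_def)
  have pic: "pic W (insert ?e F) = ?K \<union> ?A"
    by (rule pic_insert) (use chord.hyps in auto)
  have closedK: "compact ?K"
    using compact_pic f by blast
  have ends: "{pos u, pos w} = {pathstart (\<gamma> ?e), pathfinish (\<gamma> ?e)}"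
    using ends_edge[OF chord.hyps(4)] by simp
  have A: "?A - ?K = ?A - {pathstart (\<gamma> ?e), pathfinish (\<gamma> ?e)}"
    using int ends by blast
  \<comment> \<open>The chord without its ends is connected, so it runs within a single face
    \<open>R\<close>.\<close>
  have "connected (?A - ?K)" "?A - ?K \<noteq> {}"
    unfolding A using arc_imp_simple_path[OF arc_edge[OF chord.hyps(4)]]
    by (rule connected_simple_path_endless, rule nonempty_simple_path_endless)
  then obtain R where R: "R \<in> components (- ?K)" "?A - ?K \<subseteq> R"
    using exists_component_superset[of "?A - ?K" "- ?K"] by blast
  have "connected_component (- (?K \<union> ?A)) x y"
    if xy: "x \<notin> ?K \<union> ?A" "y \<notin> ?K \<union> ?A" "connected_component (- ?K) x y"
      "(x \<in> inside (path_image C)) = (y \<in> inside (path_image C))" for x y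
  proof -
    \<comment> \<open>Adding the loop to the picture is the same as adding the chord, since
      \<open>img P\<close> is drawn already.\<close>
    have "connected_component (- (?K \<union> path_image C)) x y"
    proof (rule Janiszewski)
      have "?K \<inter> path_image C = img P"
        unfolding imgC Int_Un_distrib int using imgP C(5,6) by auto
      then show "connected (?K \<inter> path_image C)"
        using C by simp
      show "closed (path_image C)"
        using C(1) by (simp add: closed_simple_path_image)
      have x: "x \<notin> path_image C" "y \<notin> path_image C"
        using xy imgC imgP by auto
      note J = Jordan_inside_outside[OF C(1,2)]
      have inC: "inside (path_image C) \<subseteq> - path_image C"
        and outC: "outside (path_image C) \<subseteq> - path_image C"
        by (simp_all add: disjoint_eq_subset_Compl[symmetric])
      show "connected_component (- path_image C) x y"
      proof (cases "x \<in> inside (path_image C)")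
        case True
        then show ?thesis
          using xy(4) J inC unfolding connected_component_def by blast
      next
        case False
        then have "x \<in> outside (path_image C)" "y \<in> outside (path_image C)"
          using False xy(4) x inside_Un_outside[of "path_image C"] by blast+
        then show ?thesis
          using J outC unfolding connected_component_def by blast
      qed
    qed (use closedK xy in auto)
    moreover have "?K \<union> path_image C = ?K \<union> ?A"
      using imgC imgP by blast
    ultimately show ?thesis by simp
  qed
  then have "finite (components (- (?K \<union> ?A))) \<and> card (components (- (?K \<union> ?A))) \<le> card (components (- ?K)) + 1"
    using chord.IH
    by (intro card_components_split_one[OF _ R, where side = "\<lambda>x. x \<in> inside (path_image C)"]) auto
  then show ?case
    using chord.IH f chord.hyps(5) by (simp add: pic)
qed

text \<open>One pair of points has to serve all even sets. Two points near an inner point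
  \<open>m\<close> of \<open>e\<close>, on different sides of a loop \<open>c\<close> through
  \<open>e\<close>, have different signs for \<open>c\<close>. An even set without \<open>e\<close>
  has no drawn edge in a small disc around \<open>m\<close>; one with \<open>e\<close> is reduced to
  this case by adding \<open>c\<close>.\<close>

lemma edge_two_sides:
  assumes F: "F \<subseteq> E" "\<Union>F \<subseteq> W" "W \<subseteq> V" "finite W" and e: "e \<in> F"
  obtains p q where "p \<notin> pic W F" "q \<notin> pic W F"
    "\<And>z. z \<in> even_sets F \<Longrightarrow> e \<in> z \<longleftrightarrow> parity_sign z p \<noteq> parity_sign z q"
proof (cases "\<exists>z\<in>even_sets F. e \<in> z")
  case False
  \<comment> \<open>No even set contains \<open>e\<close>, so any point off the bounded picture
    serves as both \<open>p\<close> and \<open>q\<close>.\<close>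
  have "pic W F \<noteq> UNIV"
    using compact_imp_bounded[OF compact_pic[OF F(4,1)]] not_bounded_UNIV by metis
  then show ?thesis
    using False that by blast
next
  case True
  then obtain z0 where z0: "z0 \<in> even_sets F" "e \<in> z0" by blast
  have eE: "e \<in> E" using e F(1) by blast
  obtain u w where uw: "e = {u, w}" "u \<noteq> w"
    using edge_card[OF eE] by (metis card_2_iff)
  have finF: "finite F"
    using F(1) finite_edges by (rule finite_subset)
  \<comment> \<open>Lying in an even set, \<open>e\<close> is not a bridge, which provides the
    loop.\<close>
  have "(u, w) \<in> (adj_rel (F - {e}))\<^sup>*"
    using even_set_edge_not_bridge[OF finF _ z0(1), of u w] edge_card F(1) z0(2) uw by blast
  then obtain X P where P: "simple_walk (F - {e}) u X P w"
    using ex_simple_walk by metis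
  note PF = simple_walk_facts(2)[OF P]
  define c where "c = insert e P"
  have c: "c \<in> even_sets F"
    unfolding c_def uw(1)
    by (rule simple_walk_closed_even[OF P uw(2)]) (use PF e uw in auto)
  have loop_prems: "F - {e} \<subseteq> E" "{u, w} \<in> E" "{u, w} \<notin> P"
    using F(1) eE PF uw(1) by auto
  obtain C where C: "simple_path C" "pathfinish C = pathstart C" "path_image C = img c"
    "\<And>p. p \<in> inside (path_image C) \<Longrightarrow> parity_sign c p = -1"
    "\<And>p. p \<in> outside (path_image C) \<Longrightarrow> parity_sign c p = 1"
    by (rule walk_loop[OF P loop_prems, folded uw(1), folded c_def]) (rule that; assumption)
  let ?A = "path_image (\<gamma> e)" and ?K = "pic W (F - {e})"
  have "?A \<inter> ?K = pos ` (e \<inter> W)"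
    by (rule edge_Int_pic) (use F eE in auto)
  then have "?A \<inter> ?K \<subseteq> {pathstart (\<gamma> e), pathfinish (\<gamma> e)}"
    using ends_edge[OF eE] by blast
  moreover have "?A - {pathstart (\<gamma> e), pathfinish (\<gamma> e)} \<noteq> {}"
    by (rule nonempty_simple_path_endless[OF arc_imp_simple_path[OF arc_edge[OF eE]]])
  ultimately obtain m where m: "m \<in> ?A" "m \<notin> ?K"
    by blast
  have "open (- ?K)"
    using compact_pic[OF F(4), of "F - {e}"] F(1) by (auto intro: compact_imp_closed)
  then obtain d where d: "d > 0" "ball m d \<subseteq> - ?K"
    using m(2) open_contains_ball by blast
  note J = Jordan_inside_outside[OF C(1,2)]
  have "?A \<subseteq> path_image C"
    unfolding C(3) by (auto simp: c_def img_def)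
  \<comment> \<open>By the Jordan curve theorem every point of the loop borders both of its
    sides.\<close>
  then have "m \<in> frontier (inside (path_image C))" "m \<in> frontier (outside (path_image C))"
    using m(1) J by auto
  then have "m \<in> closure (inside (path_image C))" "m \<in> closure (outside (path_image C))"
    by (auto simp: frontier_def)
  then obtain p q where p: "p \<in> inside (path_image C)" "p \<in> ball m d"
    and q: "q \<in> outside (path_image C)" "q \<in> ball m d"
    using d(1) unfolding closure_approachable by (metis dist_commute mem_ball)
  have pic: "pic W F \<subseteq> ?K \<union> ?A"
    by (auto simp: pic_def img_def)
  have zout: "x \<notin> pic W F" if "x \<in> ball m d" "x \<notin> path_image C" for x
    using that d(2) pic \<open>?A \<subseteq> path_image C\<close> by blast
  have pq: "p \<notin> pic W F" "q \<notin> pic W F"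
    using zout p q inside_no_overlap[of "path_image C"] outside_no_overlap[of "path_image C"] by blast+
  have const: "parity_sign y p = parity_sign y q" if "y \<in> even_sets F" "e \<notin> y" for y
  proof (rule sign_constant[of _ "ball m d"])
    show "y \<in> even_sets E"
      using that(1) even_sets_mono[OF F(1)] by blast
    have "img y \<subseteq> ?K"
      using that by (auto simp: pic_def img_def even_sets_def)
    then show "ball m d \<inter> img y = {}"
      using d(2) by blast
  qed (use p q in auto)
  have "parity_sign z p \<noteq> parity_sign z q" if z: "z \<in> even_sets F" "e \<in> z" for z
  proof -
    have sub: "z \<subseteq> F" "c \<subseteq> F" "finite z" "finite c"
      using z(1) c finF by (auto simp: even_sets_def intro: finite_subset)
    have "img (z \<union> c) \<subseteq> pic W F"
      using sub by (auto simp: pic_def img_def)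
    then have out: "p \<notin> img (z \<union> c)" "q \<notin> img (z \<union> c)" "p \<notin> img z"
      using pq by (auto simp: img_def)
    \<comment> \<open>The edge \<open>e\<close> cancels in \<open>sym_diff z c\<close>, so this set
      has equal signs at \<open>p\<close> and \<open>q\<close>, whereas the sign of \<open>c\<close>
      changes.\<close>
    have "parity_sign (sym_diff z c) p = parity_sign (sym_diff z c) q"
      using const[OF even_sets_sym_diff[OF finF z(1) c]] z(2) by (auto simp: c_def)
    then have "parity_sign z p * -1 = parity_sign z q * 1"
      using sign_sym_diff[OF sub(3,4)] out sub F(1) C p q by (metis le_supI order_trans)
    then show ?thesis
      using sign_cases[OF order_trans[OF sub(1) F(1)] out(3)] by auto
  qed
  then show ?thesis
    using that pq const by blast
qed

text \<open>This is MacLane's criterion. An even edge set is determined by the set of faces on which its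
  sign differs from the sign on a reference face. There are at least \<open>2 ^ (card F + 1 - card W)\<close>
  even sets and at most \<open>card F + 1 - card W\<close> other faces, so every set of faces occurs; the
  singletons yield the basis.\<close>

lemma even_set_2_basis:
  assumes "grown E r W F" "r \<in> V"
  obtains \<B> where "\<B> \<subseteq> even_sets F - {{}}" "card F + 1 = card \<B> + card W"
    "\<And>e. e \<in> F \<Longrightarrow> card {B \<in> \<B>. e \<in> B} \<le> 2"
proof -
  note f = grown_facts[OF assms(1)]
  have W: "W \<subseteq> V" using grown_verts assms by blast
  define \<F> where "\<F> = components (- pic W F)"
  have \<F>: "finite \<F>" "card \<F> + card W \<le> card F + 2"
    using card_faces[OF assms] by (auto simp: \<F>_def)
  have face: "\<exists>R\<in>\<F>. p \<in> R" if "p \<notin> pic W F" for p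
    using that by (intro bexI[of _ "connected_component_set (- pic W F) p"])
      (auto simp: \<F>_def intro: componentsI)
  define rep where "rep R = (SOME x. x \<in> R)" for R :: "complex set"
  have rep: "rep R \<in> R" if "R \<in> \<F>" for R
    using that in_components_nonempty by (auto simp: rep_def some_in_eq \<F>_def)
  have imgz: "img z \<subseteq> pic W F" if "z \<in> even_sets F" for z
    using that by (auto simp: even_sets_def pic_def img_def)
  have out: "rep R \<notin> pic W F" if "R \<in> \<F>" for R
    using rep[OF that] in_components_subset that by (auto simp: \<F>_def)
  have const: "parity_sign z p = parity_sign z (rep R)" if "z \<in> even_sets F" "R \<in> \<F>" "p \<in> R" for z R p
  proof (rule sign_constant[of _ R])
    show "z \<in> even_sets E"
      using that(1) even_sets_mono[OF f(3)] by blast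
    have "R \<subseteq> - pic W F" "connected R"
      using that(2) in_components_connected in_components_subset unfolding \<F>_def by blast+
    then show "connected R" "R \<inter> img z = {}"
      using imgz[OF that(1)] by auto
  qed (use that rep in auto)
  have "pic W F \<noteq> UNIV"
    using compact_imp_bounded[OF compact_pic[OF f(1,3)]] not_bounded_UNIV by metis
  then obtain R0 where R0: "R0 \<in> \<F>"
    using face by blast
  define val where "val z = {R \<in> \<F> - {R0}. parity_sign z (rep R) \<noteq> parity_sign z (rep R0)}" for z
  have sides: "\<exists>P\<in>\<F>. \<exists>Q\<in>\<F>. \<forall>z\<in>even_sets F. e \<in> z \<longleftrightarrow> parity_sign z (rep P) \<noteq> parity_sign z (rep Q)"
    if e: "e \<in> F" for e
  proof -
    obtain p q where pq: "p \<notin> pic W F" "q \<notin> pic W F"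
      "\<And>z. z \<in> even_sets F \<Longrightarrow> e \<in> z \<longleftrightarrow> parity_sign z p \<noteq> parity_sign z q"
      using edge_two_sides[OF f(3,4) W f(1) e] by blast
    then show ?thesis
      using face[OF pq(1)] face[OF pq(2)] const by metis
  qed
  have inj: "inj_on val (even_sets F)"
  proof (rule inj_onI)
    fix y z assume yz: "y \<in> even_sets F" "z \<in> even_sets F" "val y = val z"
    have sub: "y \<subseteq> F" "z \<subseteq> F" "finite y" "finite z"
      using yz f(2) by (auto simp: even_sets_def intro: finite_subset)
    let ?d = "sym_diff y z"
    have d: "?d \<in> even_sets F"
      using even_sets_sym_diff f(2) yz by blast
    have mult: "parity_sign ?d (rep R) = parity_sign y (rep R) * parity_sign z (rep R)" if "R \<in> \<F>" for R
    proof (rule sign_sym_diff[OF sub(3,4)])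
      show "y \<union> z \<subseteq> E"
        using sub f(3) by blast
      have "img (y \<union> z) = img y \<union> img z"
        by (auto simp: img_def)
      then show "rep R \<notin> img (y \<union> z)"
        using out[OF that] imgz[OF yz(1)] imgz[OF yz(2)] by blast
    qed
    have pm: "parity_sign x (rep R) = 1 \<or> parity_sign x (rep R) = -1" if "R \<in> \<F>" "x \<in> even_sets F" for R x
      using sign_cases[of x "rep R"] out[OF that(1)] imgz[OF that(2)] that(2) f(3)
      by (auto simp: even_sets_def)
    \<comment> \<open>With equal insides, \<open>?d\<close> has the same sign on all faces, and by
      \<open>sides\<close> no edge can belong to it.\<close>
    have "parity_sign ?d (rep R) = parity_sign ?d (rep R0)" if R: "R \<in> \<F>" for R
    proof (cases "R = R0")
      case False
      then have "parity_sign y (rep R) \<noteq> parity_sign y (rep R0) \<longleftrightarrow> parity_sign z (rep R) \<noteq> parity_sign z (rep R0)"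
        using yz(3) R unfolding val_def by blast
      then show ?thesis
        using pm[OF R yz(1)] pm[OF R yz(2)] pm[OF R0 yz(1)] pm[OF R0 yz(2)] mult[OF R] mult[OF R0]
        by auto
    qed simp
    then have "e \<notin> ?d" if "e \<in> F" for e
      using sides[OF that] d by metis
    then show "y = z"
      using sub by blast
  qed
  have Pow: "val ` even_sets F \<subseteq> Pow (\<F> - {R0})" "finite (Pow (\<F> - {R0}))"
    using \<F>(1) by (auto simp: val_def)
  have cE: "card W \<le> card F + 1" "2 ^ (card F + 1 - card W) \<le> card (even_sets F)"
    using grown_card_even_sets[OF assms(1)] edge_card by auto
  have cPow: "card (Pow (\<F> - {R0})) = 2 ^ (card \<F> - 1)"
    using \<F>(1) R0 by (simp add: card_Pow)
  have "card (even_sets F) \<le> 2 ^ (card \<F> - 1)"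
    using card_inj_on_le[OF inj Pow] cPow by simp
  then have "(2::nat) ^ (card F + 1 - card W) \<le> 2 ^ (card \<F> - 1)"
    using cE(2) by linarith
  then have "card F + 1 - card W \<le> card \<F> - 1"
    by simp
  \<comment> \<open>The two counts are tight; this is Euler's formula.\<close>
  then have eq: "card F + 1 = card \<F> - 1 + card W"
    using \<F>(2) cE(1) by linarith
  then have "card (val ` even_sets F) = card (Pow (\<F> - {R0}))"
    using card_image[OF inj] cPow cE(2) \<open>card (even_sets F) \<le> _\<close> by simp
  then have onto: "val ` even_sets F = Pow (\<F> - {R0})"
    by (rule card_subset_eq[OF Pow(2,1)])
  have "\<exists>z\<in>even_sets F. val z = {R}" if "R \<in> \<F> - {R0}" for R
  proof -
    have "{R} \<in> val ` even_sets F"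
      unfolding onto using that by simp
    then show ?thesis by (metis imageE)
  qed
  then obtain B where B: "\<And>R. R \<in> \<F> - {R0} \<Longrightarrow> B R \<in> even_sets F \<and> val (B R) = {R}"
    by metis
  have injB: "inj_on B (\<F> - {R0})"
    using B by (metis (no_types, lifting) inj_onI singleton_inject)
  show ?thesis
  proof (rule that[of "B ` (\<F> - {R0})"])
    have "val {} = {}"
      by (simp add: val_def parity_sign_def)
    then show "B ` (\<F> - {R0}) \<subseteq> even_sets F - {{}}"
      using B by fastforce
    show "card F + 1 = card (B ` (\<F> - {R0})) + card W"
      using eq R0 \<F>(1) by (simp add: card_image[OF injB])
    fix e assume "e \<in> F"
    then obtain P Q where PQ: "P \<in> \<F>" "Q \<in> \<F>"
      "\<And>z. z \<in> even_sets F \<Longrightarrow> e \<in> z \<longleftrightarrow> parity_sign z (rep P) \<noteq> parity_sign z (rep Q)"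
      using sides by metis
    \<comment> \<open>The sign of \<open>B R\<close> differs from its value on \<open>R0\<close>
      only on \<open>R\<close>, so \<open>R\<close> is one of the two sides of every edge of
      \<open>B R\<close>.\<close>
    have "{X \<in> B ` (\<F> - {R0}). e \<in> X} \<subseteq> {B P, B Q}"
    proof
      fix X assume "X \<in> {X \<in> B ` (\<F> - {R0}). e \<in> X}"
      then obtain R where R: "R \<in> \<F>" "R \<noteq> R0" "e \<in> B R" "X = B R"
        by blast
      have b: "B R \<in> even_sets F" "val (B R) = {R}"
        using B R by auto
      have *: "parity_sign (B R) (rep S) = parity_sign (B R) (rep R0)" if "S \<in> \<F>" "S \<noteq> R" for S
        using b(2) that unfolding val_def by blast
      have "P = R \<or> Q = R"
        using PQ(3)[OF b(1)] R(3) *[OF PQ(1)] *[OF PQ(2)] by metis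
      then show "X \<in> {B P, B Q}"
        using R(4) by blast
    qed
    then have "card {X \<in> B ` (\<F> - {R0}). e \<in> X} \<le> card {B P, B Q}"
      by (intro card_mono) auto
    also have "\<dots> \<le> 2"
      by (simp add: card_insert_if)
    finally show "card {X \<in> B ` (\<F> - {R0}). e \<in> X} \<le> 2" .
  qed
qed

text \<open>With a bonus of 2 for triangles every basis element weighs at least 5. Counting edges in
  basis elements gives \<open>5 * (m - n + 1) <= 2 * m + 2 * t\<close>.\<close>

lemma edge_bound:
  assumes "grown E r W F" "r \<in> V" "C4_free E"
  shows "3 * card F + 5 \<le> 5 * card W + 2 * card (triangles F)"
proof -
  note f = grown_facts[OF assms(1)]
  obtain \<B> where \<B>: "\<B> \<subseteq> even_sets F - {{}}" "card F + 1 = card \<B> + card W"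
    "\<And>e. e \<in> F \<Longrightarrow> card {B \<in> \<B>. e \<in> B} \<le> 2"
    using even_set_2_basis[OF assms(1,2)] by blast
  have fin: "finite \<B>" "\<And>B. B \<in> \<B> \<Longrightarrow> B \<subseteq> F" "\<And>B. B \<in> \<B> \<Longrightarrow> finite B"
    using \<B>(1) finite_even_sets[OF f(2)] f(2) by (auto simp: even_sets_def intro: finite_subset)
  have C4F: "C4_free F"
    using assms(3) f(3) unfolding C4_free_def by blast
  have finT: "finite (triangles F)"
    using f(2) by (auto simp: triangles_def intro: finite_subset[of _ "Pow F"])
  have size: "5 \<le> card B + (if B \<in> triangles F then 2 else 0)" if "B \<in> \<B>" for B
  proof -
    have "B \<in> even_sets F" "B \<noteq> {}" using \<B>(1) that by auto
    moreover have "\<forall>e\<in>F. card e = 2"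
      using edge_card f(3) by blast
    ultimately have "B \<in> triangles F \<and> card B = 3 \<or> 5 \<le> card B"
      using even_set_triangle_or_large[OF f(2) _ C4F] by blast
    then show ?thesis by auto
  qed
  have "5 * card \<B> = (\<Sum>B\<in>\<B>. 5)" by simp
  also have "\<dots> \<le> (\<Sum>B\<in>\<B>. card B + (if B \<in> triangles F then 2 else 0))"
    using size by (rule sum_mono)
  also have "\<dots> = (\<Sum>B\<in>\<B>. card B) + 2 * card (\<B> \<inter> triangles F)"
    using fin(1) by (simp add: sum.distrib sum.If_cases)
  also have "card (\<B> \<inter> triangles F) \<le> card (triangles F)"
    using finT by (intro card_mono) auto
  also have "(\<Sum>B\<in>\<B>. card B) = (\<Sum>B\<in>\<B>. \<Sum>e\<in>F. if e \<in> B then 1 else 0)"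
  proof (rule sum.cong[OF refl])
    fix B assume "B \<in> \<B>"
    then have "F \<inter> {e. e \<in> B} = B"
      using fin(2) by auto
    then show "card B = (\<Sum>e\<in>F. if e \<in> B then 1 else 0)"
      using f(2) by (simp add: sum.If_cases)
  qed
  also have "\<dots> = (\<Sum>e\<in>F. \<Sum>B\<in>\<B>. if e \<in> B then 1 else 0)"
    by (rule sum.swap)
  also have "\<dots> = (\<Sum>e\<in>F. card {B \<in> \<B>. e \<in> B})"
    using fin(1) by (simp add: sum.If_cases Int_def)
  also have "\<dots> \<le> (\<Sum>e\<in>F. 2)"
    using \<B>(3) by (rule sum_mono)
  finally have "5 * card \<B> \<le> 2 * card F + 2 * card (triangles F)"
    by simp
  then show ?thesis
    using \<B>(2) by linarith
qed

end

section \<open>Unavoidable configurations\<close>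

context drawing
begin

text \<open>Vertices of degree 3, 4, 5, 6 have weight \<open>3 - 10 / d\<close> equal to -1/3, 1/2,
  1, 4/3. Triangles dictate the thresholds: their corners must sum to 2. Degrees 3, 5, 5 would fall
  short of this, 3, 6, 6 give 7/3, and 4, 4, 5 give exactly 2.\<close>

lemma unavoidable_configurations:
  assumes "C4_free E" "E \<noteq> {}"
  obtains (light_edge) u v where "{u, v} \<in> E" "deg E u \<le> 2 \<or> deg E u = 3 \<and> deg E v \<le> 5"
  | (light_triangle) u v w where "{u, v} \<in> E" "{v, w} \<in> E" "{u, w} \<in> E" "distinct [u, v, w]"
      "deg E u \<le> 4" "deg E v \<le> 4" "deg E w \<le> 4"
proof (rule ccontr)
  assume "\<not> thesis"
  then have heavy: "3 \<le> deg E u" "deg E u = 3 \<Longrightarrow> 6 \<le> deg E v" if "{u, v} \<in> E" for u v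
    using light_edge[of u v] that by fastforce+
  have heavy_triangle: "5 \<le> deg E u \<or> 5 \<le> deg E v \<or> 5 \<le> deg E w"
    if "{u, v} \<in> E" "{v, w} \<in> E" "{u, w} \<in> E" "distinct [u, v, w]" for u v w
    using light_triangle[of u v w] that \<open>\<not> thesis\<close> by fastforce
  obtain e where e: "e \<in> E" using assms(2) by blast
  then obtain r s where rs: "{r, s} \<in> E"
    using edge_card by (metis card_2_iff)
  have r: "r \<in> V"
    using rs edge_verts by blast
  obtain W F where WF: "grown E r W F"
    "\<And>u w. u \<in> W \<Longrightarrow> {u, w} \<in> E \<Longrightarrow> w \<in> W \<and> {u, w} \<in> F"
    using grown_maximal[OF finite_edges] by blast
  note f = grown_facts[OF WF(1)]
  have deg: "deg F v = deg E v" if "v \<in> W" for v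
  proof -
    have "x \<in> F" if x: "x \<in> E" "v \<in> x" for x
    proof -
      obtain y where "x = {v, y}"
        using x edge_card[OF x(1)] by (auto simp: card_2_iff)
      then show ?thesis
        using WF(2) \<open>v \<in> W\<close> x(1) by blast
    qed
    then have "{x \<in> F. v \<in> x} = {x \<in> E. v \<in> x}"
      using f(3) by blast
    then show ?thesis by (simp add: deg_def)
  qed
  \<comment> \<open>As \<open>r\<close> is an end of an edge, no vertex of its component is
    isolated. Positive degrees are also needed to cancel the division in \<open>b\<close>.\<close>
  have deg3: "3 \<le> deg E v" if "v \<in> W" for v
  proof -
    have "(r, v) \<in> (adj_rel F)\<^sup>*"
      using grown_connected WF(1) f(5) that by metis
    then show ?thesis
    proof (cases rule: rtranclE)
      case base
      then show ?thesis using heavy(1) rs by simp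
    next
      case (step y)
      then have "{v, y} \<in> E"
        using f(3) by (auto simp: adj_rel_def insert_commute)
      then show ?thesis by (rule heavy(1))
    qed
  qed
  \<comment> \<open>Distributing \<open>3 * deg v - 10\<close>, the contribution of \<open>v\<close> to the edge bound, evenly to the edges at \<open>v\<close>.\<close>
  define b :: "'a \<Rightarrow> real" where "b v = 3 - 10 / deg E v" for v
  define \<tau> where "\<tau> x = (\<Sum>v\<in>x. b v)" for x
  have b: "3 - 10 / n \<le> b v" if "n \<le> deg E v" "0 < n" for v and n :: nat
    using that by (simp add: b_def frac_le)
  have in_W: "x \<subseteq> W" if "x \<in> F" for x
    using f(4) that by blast
  have \<tau>_nonneg: "0 \<le> \<tau> x" if x: "x \<in> F" for x
  proof -
    obtain u v where uv: "x = {u, v}" "u \<noteq> v"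
      using edge_card f(3) x by (metis card_2_iff subsetD)
    have uvE: "{u, v} \<in> E" "{v, u} \<in> E"
      using uv x f(3) by (auto simp: insert_commute)
    have "0 \<le> b u + b v"
    proof -
      consider "deg E u = 3" "6 \<le> deg E v" | "deg E v = 3" "6 \<le> deg E u" | "4 \<le> deg E u" "4 \<le> deg E v"
        using heavy[OF uvE(1)] heavy[OF uvE(2)] by linarith
      then show ?thesis
        using b[of 3 u] b[of 3 v] b[of 6 u] b[of 6 v] b[of 4 u] b[of 4 v] by cases auto
    qed
    then show ?thesis
      using uv by (simp add: \<tau>_def)
  qed
  have \<tau>_triangle: "4 \<le> (\<Sum>x\<in>T. \<tau> x)" if T: "T \<in> triangles F" for T
  proof -
    obtain x y z where xyz: "distinct [x, y, z]" "T = {{x, y}, {y, z}, {x, z}}"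
      using T by (auto simp: triangles_def)
    have TE: "{x, y} \<in> E" "{y, z} \<in> E" "{x, z} \<in> E"
      using T xyz f(3) by (auto simp: triangles_def)
    then have TE': "{y, x} \<in> E" "{z, y} \<in> E" "{z, x} \<in> E"
      by (simp_all add: insert_commute)
    have "2 \<le> b x + b y + b z"
    proof -
      have h: "3 \<le> deg E x" "3 \<le> deg E y" "3 \<le> deg E z"
        "deg E x = 3 \<Longrightarrow> 6 \<le> deg E y \<and> 6 \<le> deg E z"
        "deg E y = 3 \<Longrightarrow> 6 \<le> deg E x \<and> 6 \<le> deg E z"
        "deg E z = 3 \<Longrightarrow> 6 \<le> deg E x \<and> 6 \<le> deg E y"
        "5 \<le> deg E x \<or> 5 \<le> deg E y \<or> 5 \<le> deg E z"
        using heavy TE TE' heavy_triangle[OF TE xyz(1)] by blast+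
      have bs: "3 \<le> deg E v \<Longrightarrow> - 1 / 3 \<le> b v" "4 \<le> deg E v \<Longrightarrow> 1 / 2 \<le> b v"
        "5 \<le> deg E v \<Longrightarrow> 1 \<le> b v" "6 \<le> deg E v \<Longrightarrow> 4 / 3 \<le> b v" for v
        using b[of 3 v] b[of 4 v] b[of 5 v] b[of 6 v] by auto
      \<comment> \<open>At most one corner has degree 3, and then the other two have degree at least
        6.\<close>
      consider "6 \<le> deg E y" "6 \<le> deg E z" | "6 \<le> deg E x" "6 \<le> deg E z" | "6 \<le> deg E x" "6 \<le> deg E y"
        | "4 \<le> deg E x" "4 \<le> deg E y" "4 \<le> deg E z"
        using h by linarith
      then show ?thesis
      proof cases
        case 1
        then show ?thesis using bs(1)[OF h(1)] bs(4)[of y] bs(4)[of z] by linarith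
      next
        case 2
        then show ?thesis using bs(1)[OF h(2)] bs(4)[of x] bs(4)[of z] by linarith
      next
        case 3
        then show ?thesis using bs(1)[OF h(3)] bs(4)[of x] bs(4)[of y] by linarith
      next
        case 4
        then show ?thesis using bs(2)[of x] bs(2)[of y] bs(2)[of z] bs(3)[of x] bs(3)[of y] bs(3)[of z] h(7)
          by linarith
      qed
    qed
    \<comment> \<open>Each corner lies on two edges of the triangle.\<close>
    moreover have "(\<Sum>x\<in>T. \<tau> x) = 2 * (b x + b y + b z)"
      using xyz by (auto simp: \<tau>_def doubleton_eq_iff)
    ultimately show ?thesis by simp
  qed
  have "(\<Sum>v\<in>W. deg F v) = (\<Sum>x\<in>F. card (x \<inter> W))"
    using f by (intro sum_deg)
  also have "\<dots> = (\<Sum>x\<in>F. 2)"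
    using in_W edge_card f(3) by (intro sum.cong) (auto simp: Int_absorb2)
  finally have hs: "(\<Sum>v\<in>W. deg F v) = 2 * card F"
    by simp
  have "(\<Sum>x\<in>F. \<tau> x) = (\<Sum>x\<in>F. \<Sum>v\<in>W. if v \<in> x then b v else 0)"
  proof (rule sum.cong[OF refl])
    fix x assume "x \<in> F"
    then have "W \<inter> {v. v \<in> x} = x"
      using in_W by auto
    then show "\<tau> x = (\<Sum>v\<in>W. if v \<in> x then b v else 0)"
      using f(1) by (simp add: \<tau>_def sum.If_cases)
  qed
  also have "\<dots> = (\<Sum>v\<in>W. \<Sum>x\<in>F. if v \<in> x then b v else 0)"
    by (rule sum.swap)
  also have "\<dots> = (\<Sum>v\<in>W. real (deg F v) * b v)"
    using f(2) by (intro sum.cong) (auto simp: sum.If_cases deg_def Int_def)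
  also have "\<dots> = (\<Sum>v\<in>W. 3 * real (deg F v) - 10)"
    using deg deg3 by (intro sum.cong) (fastforce simp: b_def field_simps)+
  also have "\<dots> = 3 * real (\<Sum>v\<in>W. deg F v) - 10 * real (card W)"
    by (simp add: sum_subtractf sum_distrib_left)
  also have "\<dots> = 6 * real (card F) - 10 * real (card W)"
    using hs by simp
  \<comment> \<open>Twice \<open>edge_bound\<close>; its constant 5 makes the inequality
    strict.\<close>
  also have "\<dots> < 4 * real (card (triangles F))"
    using edge_bound[OF WF(1) r assms(1)] by linarith
  finally have upper: "(\<Sum>x\<in>F. \<tau> x) < 4 * real (card (triangles F))" .
  have C4F: "C4_free F"
    using assms(1) f(3) unfolding C4_free_def by blast
  have T: "finite (triangles F)" "\<And>T. T \<in> triangles F \<Longrightarrow> finite T" "\<Union>(triangles F) \<subseteq> F"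
    using f(2) by (auto simp: triangles_def intro: finite_subset[of _ "Pow F"])
  have "4 * real (card (triangles F)) = (\<Sum>T\<in>triangles F. 4)"
    by simp
  also have "\<dots> \<le> (\<Sum>T\<in>triangles F. \<Sum>x\<in>T. \<tau> x)"
    using \<tau>_triangle by (rule sum_mono)
  also have "\<dots> = (\<Sum>x\<in>\<Union>(triangles F). \<tau> x)"
    using T triangle_edges_disjoint[OF C4F] by (intro sum.Union_disjoint[symmetric, unfolded comp_def]) auto
  also have "\<dots> \<le> (\<Sum>x\<in>F. \<tau> x)"
    using T(3) f(2) \<tau>_nonneg by (intro sum_mono2) auto
  finally show False
    using upper by simp
qed

end

section \<open>Reducible configurations\<close>

text \<open>This is correspondence colouring (DP-colouring): \<open>M x y a b\<close> says that
  colour \<open>a\<close> at \<open>x\<close> conflicts with colour \<open>b\<close> at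
  \<open>y\<close>, and by \<open>M_inj\<close> and \<open>M_sym\<close> each \<open>M x y\<close>
  is a partial matching between the two lists. The symmetry absorbs the orientation of the
  graph.\<close>

locale conflict_coloring =
  fixes adj :: "'x \<Rightarrow> 'x \<Rightarrow> bool" and L :: "'x \<Rightarrow> 'g set" and M :: "'x \<Rightarrow> 'x \<Rightarrow> 'g \<Rightarrow> 'g \<Rightarrow> bool"
  assumes adj_sym: "adj x y \<Longrightarrow> adj y x"
    and adj_irrefl: "\<not> adj x x"
    and M_sym: "M x y a b \<Longrightarrow> M y x b a"
    and M_inj: "a \<in> L x \<Longrightarrow> a' \<in> L x \<Longrightarrow> b \<in> L y \<Longrightarrow> M x y a b \<Longrightarrow> M x y a' b \<Longrightarrow> a = a'"
    and finite_L: "finite (L x)"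
begin

definition proper :: "'x set \<Rightarrow> ('x \<Rightarrow> 'g) \<Rightarrow> bool" where
  "proper X c \<longleftrightarrow> (\<forall>x\<in>X. c x \<in> L x) \<and> (\<forall>x\<in>X. \<forall>y\<in>X. adj x y \<longrightarrow> \<not> M x y (c x) (c y))"

definition avail :: "'x set \<Rightarrow> ('x \<Rightarrow> 'g) \<Rightarrow> 'x \<Rightarrow> 'g set" where
  "avail X c x = {a \<in> L x. \<forall>y\<in>X. adj x y \<longrightarrow> \<not> M x y a (c y)}"

lemma finite_avail: "finite (avail X c x)"
  by (simp add: avail_def finite_L)

lemma card_le_1_conflict: "b \<in> L y \<Longrightarrow> card {a \<in> L x. M x y a b} \<le> 1"
  unfolding One_nat_def by (rule card_le_Suc0_iff_eq[THEN iffD2]) (auto simp: finite_L intro: M_inj)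

lemma card_avail:
  assumes "proper X c" "{y \<in> X. adj x y} \<subseteq> N" "finite N"
  shows "card (L x) \<le> card (avail X c x) + card N"
proof -
  let ?Y = "{y \<in> X. adj x y}"
  have Y: "finite ?Y" "card ?Y \<le> card N"
    using assms(2,3) by (auto intro: finite_subset card_mono)
  have "card (\<Union>y\<in>?Y. {a \<in> L x. M x y a (c y)}) \<le> (\<Sum>y\<in>?Y. card {a \<in> L x. M x y a (c y)})"
    using Y(1) by (rule card_UN_le)
  also have "\<dots> \<le> (\<Sum>y\<in>?Y. 1)"
    using assms(1) by (intro sum_mono card_le_1_conflict) (auto simp: proper_def)
  finally have "card (\<Union>y\<in>?Y. {a \<in> L x. M x y a (c y)}) \<le> card N"
    using Y(2) by simp
  moreover have "L x \<subseteq> avail X c x \<union> (\<Union>y\<in>?Y. {a \<in> L x. M x y a (c y)})"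
    by (auto simp: avail_def)
  then have "card (L x) \<le> card (avail X c x \<union> (\<Union>y\<in>?Y. {a \<in> L x. M x y a (c y)}))"
    using Y(1) finite_avail finite_L by (intro card_mono) auto
  then have "card (L x) \<le> card (avail X c x) + card (\<Union>y\<in>?Y. {a \<in> L x. M x y a (c y)})"
    using card_Un_le order_trans by blast
  ultimately show ?thesis by linarith
qed

lemma proper_extend:
  assumes "proper X c" "x \<notin> X" "a \<in> avail X c x"
  shows "proper (insert x X) (c(x := a))"
  unfolding proper_def
proof (intro conjI ballI impI)
  have a: "a \<in> L x" "\<And>y. y \<in> X \<Longrightarrow> adj x y \<Longrightarrow> \<not> M x y a (c y)"
    using assms(3) by (auto simp: avail_def)
  show "(c(x := a)) y \<in> L y" if "y \<in> insert x X" for y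
    using that a(1) assms(1) by (auto simp: proper_def)
  show "\<not> M y z ((c(x := a)) y) ((c(x := a)) z)" if "y \<in> insert x X" "z \<in> insert x X" "adj y z" for y z
  proof (cases "y = x")
    case True
    then have "z \<noteq> x"
      using that(3) adj_irrefl by auto
    then show ?thesis
      using True that a(2) by simp
  next
    case y: False
    show ?thesis
    proof (cases "z = x")
      case True
      then have "\<not> M x y a (c y)"
        using that y a(2) adj_sym by simp
      then show ?thesis
        using True y M_sym by auto
    next
      case False
      then show ?thesis
        using y that assms(1) by (simp add: proper_def)
    qed
  qed
qed

text \<open>Stated for a subset \<open>T\<close> of the free colours because
  \<open>diamond_extend\<close> follows a fixed pair of colours of \<open>x\<close>.\<close>

lemma card_avail_insert:
  assumes "T \<subseteq> avail X c y" "x \<notin> X" "a \<in> L x"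
  shows "card T \<le> card (T \<inter> avail (insert x X) (c(x := a)) y) + 1"
proof -
  have "T \<subseteq> (T \<inter> avail (insert x X) (c(x := a)) y) \<union> {b \<in> L y. M y x b a}"
    using assms(1,2) by (auto simp: avail_def)
  then have "card T \<le> card ((T \<inter> avail (insert x X) (c(x := a)) y) \<union> {b \<in> L y. M y x b a})"
    using finite_avail finite_L by (intro card_mono) auto
  also have "\<dots> \<le> card (T \<inter> avail (insert x X) (c(x := a)) y) + card {b \<in> L y. M y x b a}"
    by (rule card_Un_le)
  finally show ?thesis
    using card_le_1_conflict[OF assms(3), of y] by linarith
qed

lemma greedy_extend:
  assumes "proper X c" "x \<notin> X" "{y \<in> X. adj x y} \<subseteq> N" "finite N" "card N < card (L x)"
  obtains c' where "proper (insert x X) c'"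
proof -
  have "avail X c x \<noteq> {}"
    using card_avail[OF assms(1,3,4)] assms(5) by (metis add_0 card.empty leD)
  then show ?thesis
    using proper_extend[OF assms(1,2)] that by blast
qed

text \<open>The colour of \<open>a\<close> is chosen so that it excludes no colour from a \<open>2\<close>-list of \<open>x\<close>;
  then \<open>y\<close>, \<open>b\<close>, \<open>x\<close> can be coloured greedily in this order.\<close>

lemma diamond_extend:
  assumes c: "proper X c" and new: "a \<notin> X" "b \<notin> X" "x \<notin> X" "y \<notin> X" "distinct [a, b, x, y]"
    and xy: "\<not> adj x y"
    and lists: "3 \<le> card (avail X c a)" "3 \<le> card (avail X c b)"
      "2 \<le> card (avail X c x)" "2 \<le> card (avail X c y)"
  obtains c' where "proper (insert x (insert b (insert y (insert a X)))) c'"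
proof -
  obtain S where S: "S \<subseteq> avail X c x" "card S = 2"
    using obtain_subset_with_card_n[OF lists(3)] by blast
  have SL: "S \<subseteq> L x" "finite S"
    using S finite_avail by (auto simp: avail_def intro: finite_subset)
  \<comment> \<open>At most two colours of \<open>a\<close> conflict with \<open>S\<close>, so one
    of its three free colours is left.\<close>
  let ?bad = "\<Union>s\<in>S. {\<alpha> \<in> L a. M a x \<alpha> s}"
  have "card ?bad \<le> (\<Sum>s\<in>S. card {\<alpha> \<in> L a. M a x \<alpha> s})"
    using SL(2) by (rule card_UN_le)
  also have "\<dots> \<le> (\<Sum>s\<in>S. 1)"
    using SL(1) by (intro sum_mono card_le_1_conflict) auto
  finally have "card ?bad < card (avail X c a)"
    using S(2) lists(1) by simp
  moreover have "finite ?bad"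
    using SL(2) finite_L by auto
  ultimately obtain \<alpha> where \<alpha>: "\<alpha> \<in> avail X c a" "\<alpha> \<notin> ?bad"
    by (meson card_mono leD subsetI)
  define c1 X1 where "c1 = c(a := \<alpha>)" and "X1 = insert a X"
  have aL: "\<alpha> \<in> L a" using \<alpha>(1) by (simp add: avail_def)
  have p1: "proper X1 c1"
    unfolding c1_def X1_def by (rule proper_extend[OF c new(1) \<alpha>(1)])
  have S1: "S \<subseteq> avail X1 c1 x"
    using S(1) \<alpha>(2) aL M_sym new(1) by (auto simp: c1_def X1_def avail_def)
  have "card (avail X c y) \<le> card (avail X c y \<inter> avail X1 c1 y) + 1"
    "card (avail X c b) \<le> card (avail X c b \<inter> avail X1 c1 b) + 1"
    unfolding c1_def X1_def using card_avail_insert[OF _ new(1) aL] by blast+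
  moreover have "card (avail X c y \<inter> avail X1 c1 y) \<le> card (avail X1 c1 y)"
    "card (avail X c b \<inter> avail X1 c1 b) \<le> card (avail X1 c1 b)"
    using finite_avail by (auto intro: card_mono)
  ultimately have y1: "1 \<le> card (avail X1 c1 y)" and b1: "2 \<le> card (avail X1 c1 b)"
    using lists by linarith+
  then obtain \<beta> where \<beta>: "\<beta> \<in> avail X1 c1 y"
    by (metis card.empty ex_in_conv not_one_le_zero)
  define c2 X2 where "c2 = c1(y := \<beta>)" and "X2 = insert y X1"
  have yX1: "y \<notin> X1" using new by (auto simp: X1_def)
  have bL: "\<beta> \<in> L y" using \<beta> by (simp add: avail_def)
  have p2: "proper X2 c2"
    unfolding c2_def X2_def by (rule proper_extend[OF p1 yX1 \<beta>])
  \<comment> \<open>\<open>x\<close> and \<open>y\<close> are not adjacent, so colouring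
    \<open>y\<close> leaves \<open>S\<close> intact; afterwards only \<open>b\<close> can exclude
    one of its two colours.\<close>
  have S2: "S \<subseteq> avail X2 c2 x"
    using S1 xy yX1 by (auto simp: c2_def X2_def avail_def)
  have "card (avail X1 c1 b) \<le> card (avail X1 c1 b \<inter> avail X2 c2 b) + 1"
    unfolding c2_def X2_def using card_avail_insert[OF _ yX1 bL] by blast
  moreover have "card (avail X1 c1 b \<inter> avail X2 c2 b) \<le> card (avail X2 c2 b)"
    using finite_avail by (auto intro: card_mono)
  ultimately have "1 \<le> card (avail X2 c2 b)"
    using b1 by linarith
  then obtain \<delta> where \<delta>: "\<delta> \<in> avail X2 c2 b"
    by (metis card.empty ex_in_conv not_one_le_zero)
  define c3 X3 where "c3 = c2(b := \<delta>)" and "X3 = insert b X2"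
  have bX2: "b \<notin> X2" using new by (auto simp: X1_def X2_def)
  have dL: "\<delta> \<in> L b" using \<delta> by (simp add: avail_def)
  have p3: "proper X3 c3"
    unfolding c3_def X3_def by (rule proper_extend[OF p2 bX2 \<delta>])
  have "card S \<le> card (S \<inter> avail X3 c3 x) + 1"
    unfolding c3_def X3_def by (rule card_avail_insert[OF S2 bX2 dL])
  then have "S \<inter> avail X3 c3 x \<noteq> {}"
    using S(2) by auto
  then obtain \<xi> where \<xi>: "\<xi> \<in> avail X3 c3 x" by blast
  have "x \<notin> X3" using new by (auto simp: X1_def X2_def X3_def)
  then have "proper (insert x X3) (c3(x := \<xi>))"
    using proper_extend p3 \<xi> by blast
  then show ?thesis
    using that unfolding X3_def X2_def X1_def by blast
qed

end

text \<open>Membership in the total graph is left to \<open>elements\<close>, so that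
  \<open>E\<close> enters only for two vertices. Deleting the edge \<open>uv\<close> thus changes
  adjacency only between \<open>u\<close> and \<open>v\<close>.\<close>

fun total_adj :: "'a set set \<Rightarrow> 'a + 'a set \<Rightarrow> 'a + 'a set \<Rightarrow> bool" where
  "total_adj E (Inl u) (Inl v) \<longleftrightarrow> u \<noteq> v \<and> {u, v} \<in> E"
| "total_adj E (Inl v) (Inr e) \<longleftrightarrow> v \<in> e"
| "total_adj E (Inr e) (Inl v) \<longleftrightarrow> v \<in> e"
| "total_adj E (Inr e) (Inr f) \<longleftrightarrow> e \<noteq> f \<and> e \<inter> f \<noteq> {}"

lemma total_adj_sym: "total_adj E x y \<Longrightarrow> total_adj E y x"
  by (cases x; cases y) (auto simp: insert_commute)

lemma total_adj_irrefl: "\<not> total_adj E x x"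
  by (cases x) auto

definition elements :: "'a set \<Rightarrow> 'a set set \<Rightarrow> ('a + 'a set) set" where
  "elements V E = Inl ` V \<union> Inr ` E"

definition nbrs :: "'a set set \<Rightarrow> 'a \<Rightarrow> 'a set" where
  "nbrs E u = {v. v \<noteq> u \<and> {u, v} \<in> E}"

lemma total_adj_vertex: "total_adj E (Inl u) y \<longleftrightarrow> y \<in> Inl ` nbrs E u \<union> Inr ` {f. u \<in> f}"
  by (cases y) (auto simp: nbrs_def)

lemma total_adj_edge:
  "total_adj E (Inr {u, v}) y \<longleftrightarrow> y \<in> {Inl u, Inl v} \<union> Inr ` {f. f \<noteq> {u, v} \<and> (u \<in> f \<or> v \<in> f)}"
  by (cases y) auto

lemma card_nbrs:
  assumes "finite E" "\<forall>e\<in>E. card e = 2"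
  shows "finite (nbrs E u) \<and> card (nbrs E u) = deg E u"
proof -
  have "bij_betw (\<lambda>v. {u, v}) (nbrs E u) {e \<in> E. u \<in> e}"
  proof (rule bij_betw_imageI)
    show "inj_on (\<lambda>v. {u, v}) (nbrs E u)"
      by (auto simp: inj_on_def nbrs_def doubleton_eq_iff)
    show "(\<lambda>v. {u, v}) ` nbrs E u = {e \<in> E. u \<in> e}"
    proof
      show "{e \<in> E. u \<in> e} \<subseteq> (\<lambda>v. {u, v}) ` nbrs E u"
      proof
        fix e assume e: "e \<in> {e \<in> E. u \<in> e}"
        then obtain p q where "e = {p, q}" "p \<noteq> q"
          using assms(2) by (auto simp: card_2_iff)
        then have "e = {u, q} \<and> q \<noteq> u \<or> e = {u, p} \<and> p \<noteq> u"
          using e by auto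
        then show "e \<in> (\<lambda>v. {u, v}) ` nbrs E u"
          using e by (auto simp: nbrs_def)
      qed
    qed (auto simp: nbrs_def)
  qed
  then show ?thesis
    using assms(1) by (auto simp: deg_def bij_betw_same_card dest: bij_betw_finite)
qed

text \<open>Lists and conflicts are fixed for the whole graph \<open>E0\<close>, while the induction
  runs through subsets \<open>E\<close>; the sublocale therefore provides the colouring lemmas for
  every \<open>E\<close>.\<close>

locale total_coloring =
  fixes V :: "'a set" and E0 :: "'a set set" and k :: nat
    and L :: "'a + 'a set \<Rightarrow> 'g set" and M :: "'a + 'a set \<Rightarrow> 'a + 'a set \<Rightarrow> 'g \<Rightarrow> 'g \<Rightarrow> bool"
  assumes finite_E0: "finite E0"
    and card_E0: "\<And>e. e \<in> E0 \<Longrightarrow> card e = 2"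
    and verts_E0: "\<And>e. e \<in> E0 \<Longrightarrow> e \<subseteq> V"
    and M_sym: "\<And>x y a b. M x y a b \<Longrightarrow> M y x b a"
    and M_inj: "\<And>x y a a' b. a \<in> L x \<Longrightarrow> a' \<in> L x \<Longrightarrow> b \<in> L y \<Longrightarrow> M x y a b \<Longrightarrow> M x y a' b \<Longrightarrow> a = a'"
    and finite_L: "\<And>x. finite (L x)"
    and card_L: "\<And>x. x \<in> elements V E0 \<Longrightarrow> card (L x) = k + 2"
    and k6: "6 \<le> k"
begin

sublocale cc: conflict_coloring "total_adj E" L M for E
  by unfold_locales (auto intro: total_adj_sym M_sym M_inj finite_L simp: total_adj_irrefl)

definition colorable :: "'a set set \<Rightarrow> bool" where
  "colorable E \<longleftrightarrow> (\<exists>c. cc.proper E (elements V E) c)"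

section \<open>Deleting light edges and edges of light triangles\<close>

lemma other_edges:
  assumes "E \<subseteq> E0" "e \<in> E" "u \<in> e"
  shows "finite {f \<in> E - {e}. u \<in> f}" "card {f \<in> E - {e}. u \<in> f} + 1 = deg E u"
proof -
  have fin: "finite {f \<in> E. u \<in> f}"
    using assms(1) finite_E0 by (auto intro: finite_subset)
  have "{f \<in> E - {e}. u \<in> f} = {f \<in> E. u \<in> f} - {e}"
    by auto
  then show "finite {f \<in> E - {e}. u \<in> f}" "card {f \<in> E - {e}. u \<in> f} + 1 = deg E u"
    using fin assms(2,3) card.remove[OF fin, of e] by (auto simp: deg_def)
qed

text \<open>The two adjacencies differ only between \<open>u\<close> and \<open>v\<close>, so a
  proper colouring stays proper in \<open>E\<close> once \<open>u\<close> is uncoloured.\<close>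

lemma proper_delete_edge:
  assumes "cc.proper (E - {{u, v}}) (elements V (E - {{u, v}})) c" "X \<subseteq> elements V (E - {{u, v}})" "Inl u \<notin> X"
  shows "cc.proper E X c"
proof -
  have "total_adj (E - {{u, v}}) x y" if "x \<in> X" "y \<in> X" "total_adj E x y" for x y
    using that assms(3) by (cases x; cases y) (auto simp: doubleton_eq_iff)
  then show ?thesis
    using assms(1,2) unfolding cc.proper_def by blast
qed

text \<open>With \<open>u\<close> uncoloured, the edge \<open>uv\<close> sees \<open>v\<close> and
  \<open>deg E u + deg E v - 2\<close> edges, at most \<open>k + 1\<close> elements. Afterwards
  \<open>u\<close> sees \<open>deg E u\<close> vertices and as many edges, again at most
  \<open>k + 1\<close>.\<close>

lemma colorable_light_edge:
  assumes E: "E \<subseteq> E0" and uv: "{u, v} \<in> E" and col: "colorable (E - {{u, v}})"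
    and light: "2 * deg E u \<le> k + 1" "deg E u + deg E v \<le> k + 2"
  shows "colorable E"
proof -
  let ?e = "{u, v}"
  obtain c where c: "cc.proper (E - {?e}) (elements V (E - {?e})) c"
    using col colorable_def by blast
  have finE: "finite E" using E finite_E0 by (rule finite_subset)
  have verts: "u \<in> V" "v \<in> V"
    using verts_E0 E uv by blast+
  define X where "X = elements V (E - {?e}) - {Inl u}"
  have p: "cc.proper E X c"
    by (rule proper_delete_edge[OF c]) (auto simp: X_def)
  note ou = other_edges[OF E uv, of u, simplified] and ov = other_edges[OF E uv, of v, simplified]
  define N :: "('a + 'a set) set" where "N = {Inl v} \<union> (Inr ` {f \<in> E - {?e}. u \<in> f} \<union> Inr ` {f \<in> E - {?e}. v \<in> f})"
  have "card N \<le> card {Inl v :: 'a + 'a set} + (card (Inr ` {f \<in> E - {?e}. u \<in> f} :: ('a + 'a set) set)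
      + card (Inr ` {f \<in> E - {?e}. v \<in> f} :: ('a + 'a set) set))"
    unfolding N_def by (rule order_trans[OF card_Un_le add_left_mono[OF card_Un_le]])
  also have "\<dots> = 1 + (card {f \<in> E - {?e}. u \<in> f} + card {f \<in> E - {?e}. v \<in> f})"
    by (simp add: card_image)
  also have "\<dots> < k + 2"
    using other_edges(2)[OF E uv, of u] other_edges(2)[OF E uv, of v] light(2) by simp
  finally have "card N < card (L (Inr ?e))"
    using card_L[of "Inr ?e"] E uv by (auto simp: elements_def)
  moreover have "finite N"
    using finE by (auto simp: N_def)
  moreover have "{y \<in> X. total_adj E (Inr ?e) y} \<subseteq> N"
    unfolding total_adj_edge X_def N_def elements_def by blast
  moreover have "Inr ?e \<notin> X"
    by (auto simp: X_def elements_def)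
  ultimately obtain c1 where c1: "cc.proper E (insert (Inr ?e) X) c1"
    using cc.greedy_extend[OF p] by blast
  define N1 :: "('a + 'a set) set" where "N1 = Inl ` nbrs E u \<union> Inr ` {f \<in> E. u \<in> f}"
  have nb: "finite (nbrs E u)" "card (nbrs E u) = deg E u"
    using card_nbrs[OF finE] card_E0 E by blast+
  have "card N1 \<le> card (Inl ` nbrs E u :: ('a + 'a set) set) + card (Inr ` {f \<in> E. u \<in> f} :: ('a + 'a set) set)"
    unfolding N1_def by (rule card_Un_le)
  also have "\<dots> = 2 * deg E u"
    using nb(2) by (simp add: card_image deg_def)
  finally have "card N1 < card (L (Inl u))"
    using light(1) card_L[of "Inl u"] verts by (auto simp: elements_def)
  moreover have "finite N1"
    using nb finE by (auto simp: N1_def)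
  moreover have "{y \<in> insert (Inr ?e) X. total_adj E (Inl u) y} \<subseteq> N1"
    unfolding total_adj_vertex X_def N1_def elements_def using uv by blast
  moreover have "Inl u \<notin> insert (Inr ?e) X"
    by (auto simp: X_def)
  ultimately obtain c2 where c2: "cc.proper E (insert (Inl u) (insert (Inr ?e) X)) c2"
    using cc.greedy_extend[OF c1] by blast
  have "insert (Inl u) (insert (Inr ?e) X) = elements V E"
    using uv verts by (auto simp: X_def elements_def)
  then show ?thesis
    using c2 unfolding colorable_def by auto
qed

text \<open>With \<open>u\<close>, \<open>v\<close>, \<open>w\<close> and \<open>uv\<close>
  uncoloured, each of \<open>u\<close> and \<open>v\<close> sees at most 2 vertices and 3 edges,
  \<open>uv\<close> at most 6 edges, and \<open>w\<close> at most 2 vertices and 4 edges. Lists of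
  size 8 leave 3, 3, 2 and 2 colours, as the diamond requires; \<open>uv\<close> and
  \<open>w\<close> are its non-adjacent pair.\<close>

lemma colorable_light_triangle:
  assumes E: "E \<subseteq> E0" and tri: "{u, v} \<in> E" "{v, w} \<in> E" "{u, w} \<in> E" "distinct [u, v, w]"
    and col: "colorable (E - {{u, v}})"
    and light: "deg E u \<le> 4" "deg E v \<le> 4" "deg E w \<le> 4"
  shows "colorable E"
proof -
  let ?e = "{u, v}"
  obtain c where c: "cc.proper (E - {?e}) (elements V (E - {?e})) c"
    using col colorable_def by blast
  have finE: "finite E" using E finite_E0 by (rule finite_subset)
  have verts: "u \<in> V" "v \<in> V" "w \<in> V"
    using verts_E0 E tri by blast+
  define X where "X = elements V (E - {?e}) - {Inl u, Inl v, Inl w}"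
  have p: "cc.proper E X c"
    by (rule proper_delete_edge[OF c]) (auto simp: X_def)
  have list8: "8 \<le> card (L x)" if "x \<in> elements V E0" for x
    using card_L[OF that] k6 by simp
  have nb: "finite (nbrs E x)" "card (nbrs E x) = deg E x" for x
    using card_nbrs[OF finE] card_E0 E by blast+
  \<comment> \<open>Covers both ends of \<open>uv\<close>: \<open>x\<close> is the one considered,
    \<open>y\<close> the other.\<close>
  have ends: "3 \<le> card (cc.avail E X c (Inl x))"
    if x: "deg E x \<le> 4" "x \<in> ?e" "{y, w} \<subseteq> nbrs E x" "y \<noteq> w" "{y, w} \<union> {x} = {u, v, w}" for x y
  proof -
    define N :: "('a + 'a set) set" where "N = Inl ` (nbrs E x - {y, w}) \<union> Inr ` {f \<in> E - {?e}. x \<in> f}"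
    have "card (nbrs E x - {y, w}) = deg E x - 2"
      using nb x(3,4) by (simp add: card_Diff_subset)
    then have "card (Inl ` (nbrs E x - {y, w}) :: ('a + 'a set) set) \<le> 2"
      using x(1) by (simp add: card_image)
    moreover have "card (Inr ` {f \<in> E - {?e}. x \<in> f} :: ('a + 'a set) set) \<le> 3"
      using other_edges(2)[OF E tri(1) x(2)] x(1) by (simp add: card_image)
    ultimately have "card N \<le> 5"
      unfolding N_def using card_Un_le[of "Inl ` (nbrs E x - {y, w})" "Inr ` {f \<in> E - {?e}. x \<in> f}"] by linarith
    moreover have "card (L (Inl x)) \<le> card (cc.avail E X c (Inl x)) + card N"
    proof (rule cc.card_avail[OF p])
      show "{z \<in> X. total_adj E (Inl x) z} \<subseteq> N"
        unfolding total_adj_vertex X_def N_def elements_def using x(5) by blast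
      show "finite N"
        using nb finE by (auto simp: N_def)
    qed
    moreover have "8 \<le> card (L (Inl x))"
      using list8[of "Inl x"] x(2) verts by (auto simp: elements_def)
    ultimately show ?thesis by linarith
  qed
  have uw: "3 \<le> card (cc.avail E X c (Inl u))" "3 \<le> card (cc.avail E X c (Inl v))"
    using tri light by (auto intro!: ends[of u v] ends[of v u] simp: nbrs_def insert_commute)
  have e: "2 \<le> card (cc.avail E X c (Inr ?e))"
  proof -
    define N :: "('a + 'a set) set" where "N = Inr ` {f \<in> E - {?e}. u \<in> f} \<union> Inr ` {f \<in> E - {?e}. v \<in> f}"
    have "card (Inr ` {f \<in> E - {?e}. x \<in> f} :: ('a + 'a set) set) \<le> 3" if "x \<in> ?e" for x
      using other_edges(2)[OF E tri(1) that] light that by (auto simp: card_image)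
    from add_mono[OF this[of u] this[of v]] have "card N \<le> 6"
      unfolding N_def by (intro order_trans[OF card_Un_le]) simp
    moreover have "card (L (Inr ?e)) \<le> card (cc.avail E X c (Inr ?e)) + card N"
    proof (rule cc.card_avail[OF p])
      show "{z \<in> X. total_adj E (Inr ?e) z} \<subseteq> N"
        unfolding total_adj_edge X_def N_def elements_def by blast
      show "finite N"
        using finE by (auto simp: N_def)
    qed
    moreover have "8 \<le> card (L (Inr ?e))"
      using list8[of "Inr ?e"] tri(1) E by (auto simp: elements_def)
    ultimately show ?thesis by linarith
  qed
  have w: "2 \<le> card (cc.avail E X c (Inl w))"
  proof -
    define N :: "('a + 'a set) set" where "N = Inl ` (nbrs E w - {u, v}) \<union> Inr ` {f \<in> E. w \<in> f}"
    have "{u, v} \<subseteq> nbrs E w" "u \<noteq> v"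
      using tri by (auto simp: nbrs_def insert_commute)
    then have "card (nbrs E w - {u, v}) = deg E w - 2"
      using nb by (simp add: card_Diff_subset)
    then have "card (Inl ` (nbrs E w - {u, v}) :: ('a + 'a set) set) \<le> 2"
      using light(3) by (simp add: card_image)
    moreover have "card (Inr ` {f \<in> E. w \<in> f} :: ('a + 'a set) set) \<le> 4"
      using light(3) by (simp add: card_image deg_def)
    ultimately have "card N \<le> 6"
      unfolding N_def using card_Un_le[of "Inl ` (nbrs E w - {u, v})" "Inr ` {f \<in> E. w \<in> f}"] by linarith
    moreover have "card (L (Inl w)) \<le> card (cc.avail E X c (Inl w)) + card N"
    proof (rule cc.card_avail[OF p])
      show "{z \<in> X. total_adj E (Inl w) z} \<subseteq> N"
        unfolding total_adj_vertex X_def N_def elements_def by blast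
      show "finite N"
        using nb finE by (auto simp: N_def)
    qed
    moreover have "8 \<le> card (L (Inl w))"
      using list8[of "Inl w"] verts by (auto simp: elements_def)
    ultimately show ?thesis by linarith
  qed
  obtain c' where c': "cc.proper E (insert (Inr ?e) (insert (Inl v) (insert (Inl w) (insert (Inl u) X)))) c'"
    by (rule cc.diamond_extend[OF p _ _ _ _ _ _ uw e w]) (use tri(4) in \<open>auto simp: X_def elements_def\<close>)
  have "insert (Inr ?e) (insert (Inl v) (insert (Inl w) (insert (Inl u) X))) = elements V E"
    using tri verts by (auto simp: X_def elements_def)
  then show ?thesis
    using c' unfolding colorable_def by auto
qed

lemma colorable_no_edges: "colorable {}"
proof -
  have "L (Inl v) \<noteq> {}" if "v \<in> V" for v
    using card_L[of "Inl v"] that by (auto simp: elements_def)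
  then have "cc.proper {} (elements V {}) (\<lambda>x. SOME a. a \<in> L x)"
    unfolding cc.proper_def elements_def by (auto simp: some_in_eq)
  then show ?thesis
    unfolding colorable_def by blast
qed

lemma colorable_planar:
  assumes "drawing V E0 pos \<gamma>" "C4_free E0" "\<And>v. deg E0 v \<le> k"
  shows "colorable E0"
proof -
  have "E \<subseteq> E0 \<Longrightarrow> colorable E" if "finite E" for E
    using that
  proof (induction E rule: finite_psubset_induct)
    case (psubset E)
    show ?case
    proof (cases "E = {}")
      case True
      then show ?thesis using colorable_no_edges by simp
    next
      case False
      interpret E0: drawing V E0 pos \<gamma> by fact
      interpret drawing V E pos \<gamma>
        using psubset.prems psubset.hyps E0.edge_card E0.edge_verts E0.pos_inj E0.arc_edge E0.ends_edge
          E0.edge_meets_verts E0.edges_meet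
        by unfold_locales (auto simp: subset_iff)
      have C4: "C4_free E"
        using assms(2) psubset.prems unfolding C4_free_def by blast
      have degk: "deg E x \<le> k" for x
        using deg_mono[OF finite_E0 psubset.prems] assms(3) order_trans by blast
      have IH: "colorable (E - {e})" if "e \<in> E" for e
        using psubset.IH[of "E - {e}"] psubset.prems that by blast
      show ?thesis
      proof (rule unavoidable_configurations[OF C4 False])
        fix u v assume uv: "{u, v} \<in> E" "deg E u \<le> 2 \<or> deg E u = 3 \<and> deg E v \<le> 5"
        \<comment> \<open>For \<open>deg E u <= 2\<close> the second bound follows from
          \<open>deg E v <= k\<close>; for degrees 3 and 5 it reads
          \<open>8 <= k + 2\<close>.\<close>
        then have "2 * deg E u \<le> k + 1" "deg E u + deg E v \<le> k + 2"
          using k6 degk[of v] by auto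
        then show ?thesis
          using colorable_light_edge psubset.prems uv(1) IH by blast
      next
        fix u v w
        assume "{u, v} \<in> E" "{v, w} \<in> E" "{u, w} \<in> E" "distinct [u, v, w]"
          "deg E u \<le> 4" "deg E v \<le> 4" "deg E w \<le> 4"
        then show ?thesis
          using colorable_light_triangle psubset.prems IH by blast
      qed
    qed
  qed
  then show ?thesis
    using finite_E0 by blast
qed

end

text \<open>Only one of the two arcs belongs to \<open>D\<close>, so both equations concern the same
  arc and cancellation applies, in the reversed case to the inverses.\<close>

lemma group_conflict_unique:
  fixes A :: "'g monoid"
  assumes "group A" "orientation H D" "f ` D \<subseteq> carrier A"
    and "a \<in> carrier A" "a' \<in> carrier A" "b \<in> carrier A"
    and "(x, y) \<in> D \<and> a \<otimes>\<^bsub>A\<^esub> inv\<^bsub>A\<^esub> b = f (x, y) \<or> (y, x) \<in> D \<and> b \<otimes>\<^bsub>A\<^esub> inv\<^bsub>A\<^esub> a = f (y, x)"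
    and "(x, y) \<in> D \<and> a' \<otimes>\<^bsub>A\<^esub> inv\<^bsub>A\<^esub> b = f (x, y) \<or> (y, x) \<in> D \<and> b \<otimes>\<^bsub>A\<^esub> inv\<^bsub>A\<^esub> a' = f (y, x)"
  shows "a = a'"
proof -
  interpret group A by fact
  have "\<not> ((x, y) \<in> D \<and> (y, x) \<in> D)"
    using assms(2) unfolding orientation_def by blast
  then consider "a \<otimes>\<^bsub>A\<^esub> inv\<^bsub>A\<^esub> b = a' \<otimes>\<^bsub>A\<^esub> inv\<^bsub>A\<^esub> b" | "b \<otimes>\<^bsub>A\<^esub> inv\<^bsub>A\<^esub> a = b \<otimes>\<^bsub>A\<^esub> inv\<^bsub>A\<^esub> a'"
    using assms(7,8) by metis
  then show ?thesis
  proof cases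
    case 1
    then show ?thesis
      using assms(4-6) by simp
  next
    case 2
    then have "inv\<^bsub>A\<^esub> a = inv\<^bsub>A\<^esub> a'"
      using assms(4-6) by simp
    then show ?thesis
      using assms(4,5) by (metis inv_inv)
  qed
qed

section \<open>From digraphs and group colourings to edge sets and conflicts\<close>

context
  fixes G :: "'a pair_pre_digraph"
  assumes G: "pair_graph G"
begin

interpretation pair_graph G by (rule G)

lemma uedges_iff: "{u, v} \<in> uedges G \<longleftrightarrow> (u, v) \<in> parcs G"
proof -
  have "(u, v) \<in> parcs G \<longleftrightarrow> (v, u) \<in> parcs G"
    using pair_sym_arcs by (auto simp: symmetric_def dest: symD)
  then show ?thesis
    by (auto simp: uedges_def doubleton_eq_iff)
qed

lemma uedges_simple:
  assumes "e \<in> uedges G"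
  shows "card e = 2" "e \<subseteq> pverts G"
  using assms by (auto simp: uedges_def dest: no_loops' in_arcsD1 in_arcsD2)

lemma finite_uedges: "finite (uedges G)"
  using pair_finite_arcs by (simp add: uedges_def)

lemma deg_uedges: "deg (uedges G) v \<le> max_degree G"
proof (cases "v \<in> pverts G")
  case True
  have nb: "finite (nbrs (uedges G) v)" "card (nbrs (uedges G) v) = deg (uedges G) v"
    using card_nbrs[OF finite_uedges] uedges_simple(1) by blast+
  have "out_arcs (with_proj G) v = Pair v ` nbrs (uedges G) v"
    by (auto simp: out_arcs_def nbrs_def uedges_iff image_iff dest: no_loops')
  then have "out_degree (with_proj G) v = deg (uedges G) v"
    using nb(2) by (simp add: out_degree_def card_image inj_on_def)
  then show ?thesis
    using True pair_finite_verts unfolding max_degree_def by (intro Max_ge) force+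
next
  case False
  then have "{e \<in> uedges G. v \<in> e} = {}"
    using uedges_simple(2) by blast
  then show ?thesis
    unfolding deg_def by (simp only: card.empty)
qed

lemma C4_free_uedges:
  assumes "\<not> (\<exists>p. pre_digraph.cycle (with_proj G) p \<and> length p = 4)"
  shows "C4_free (uedges G)"
  unfolding C4_free_def
proof (intro allI impI notI)
  fix a b c d
  assume "{a, b} \<in> uedges G" "{b, c} \<in> uedges G" "{c, d} \<in> uedges G" "{d, a} \<in> uedges G"
    and dist: "distinct [a, b, c, d]"
  then have "(a, b) \<in> parcs G" "(b, c) \<in> parcs G" "(c, d) \<in> parcs G" "(d, a) \<in> parcs G"
    by (simp_all add: uedges_iff)
  then have "cycle [(a, b), (b, c), (c, d), (d, a)]"
    using dist by (auto simp: cycle_def awalk_def intro!: exI[of _ a] dest: in_arcsD1)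
  then show False
    using assms by auto
qed

lemma drawing_uedges:
  assumes "plane_drawing G pos \<gamma>"
  shows "drawing (pverts G) (uedges G) pos \<gamma>"
  using assms finite_uedges uedges_simple unfolding plane_drawing_def
  by unfold_locales auto

lemma parcs_total_graph:
  "(x, y) \<in> parcs (total_graph G) \<longleftrightarrow>
     total_adj (uedges G) x y \<and> x \<in> elements (pverts G) (uedges G) \<and> y \<in> elements (pverts G) (uedges G)"
  using uedges_simple(2)
  by (cases x; cases y) (auto simp: total_graph_def elements_def uedges_iff dest: no_loops' in_arcsD1 in_arcsD2)

lemma total_graph_choosable:
  assumes "planar_graph G" "max_degree G \<le> k" "6 \<le> k" "C4_free (uedges G)"
  shows "group_choosable TYPE('g) (total_graph G) (k + 2)"
  unfolding group_choosable_def
proof (intro allI impI, elim conjE)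
  fix D and A :: "'g monoid" and L f
  assume D: "orientation (total_graph G) D" and A: "group A"
    and L: "\<forall>v\<in>pverts (total_graph G). L v \<subseteq> carrier A \<and> finite (L v) \<and> card (L v) = k + 2"
    and f: "f ` D \<subseteq> carrier A"
  obtain pos \<gamma> where "plane_drawing G pos \<gamma>"
    using assms(1) planar_graph_def by blast
  then have draw: "drawing (pverts G) (uedges G) pos \<gamma>"
    by (rule drawing_uedges)
  let ?S = "elements (pverts G) (uedges G)"
  have S: "pverts (total_graph G) = ?S"
    by (simp add: total_graph_def elements_def)
  \<comment> \<open>Lists outside the total graph are made empty, since
    \<open>total_coloring\<close> asks for finite lists and unique conflicts on the whole
    type.\<close>
  define L' where "L' x = (if x \<in> ?S then L x else {})" for x
  \<comment> \<open>Violation of whichever arc joins \<open>x\<close> and \<open>y\<close>, which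
    makes the relation symmetric.\<close>
  define M where "M x y a b \<longleftrightarrow> (x, y) \<in> D \<and> a \<otimes>\<^bsub>A\<^esub> inv\<^bsub>A\<^esub> b = f (x, y)
      \<or> (y, x) \<in> D \<and> b \<otimes>\<^bsub>A\<^esub> inv\<^bsub>A\<^esub> a = f (y, x)" for x y a b
  have L'A: "a \<in> carrier A" if "a \<in> L' x" for a x
    using that L S by (auto simp: L'_def split: if_splits)
  interpret total_coloring "pverts G" "uedges G" k L' M
  proof
    show "M x y a b \<Longrightarrow> M y x b a" for x y a b
      by (auto simp: M_def)
    show "a = a'" if "a \<in> L' x" "a' \<in> L' x" "b \<in> L' y" "M x y a b" "M x y a' b" for x y a a' b
      using group_conflict_unique[OF A D f] L'A that unfolding M_def by metis
    show "finite (L' x)" for x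
      using L S by (simp add: L'_def)
  qed (use finite_uedges uedges_simple L S assms(3) in \<open>auto simp: L'_def\<close>)
  have "deg (uedges G) v \<le> k" for v
    using deg_uedges assms(2) order_trans by blast
  then have "colorable (uedges G)"
    using colorable_planar[OF draw assms(4)] by blast
  then obtain c where c: "cc.proper (uedges G) ?S c"
    unfolding colorable_def by blast
  have "group_coloring (total_graph G) D A L f c"
    unfolding group_coloring_def
  proof (intro conjI ballI allI impI)
    show "c v \<in> L v" if "v \<in> pverts (total_graph G)" for v
      using c that S by (auto simp: cc.proper_def L'_def)
    show "c x \<otimes>\<^bsub>A\<^esub> inv\<^bsub>A\<^esub> c y \<noteq> f (x, y)" if xy: "(x, y) \<in> D" for x y
    proof -
      have "(x, y) \<in> parcs (total_graph G)"
        using D xy unfolding orientation_def by blast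
      then have "\<not> M x y (c x) (c y)"
        using c unfolding parcs_total_graph cc.proper_def by blast
      then show ?thesis
        using xy by (auto simp: M_def)
    qed
  qed
  then show "\<exists>c. group_coloring (total_graph G) D A L f c"
    by blast
qed

end

theorem theorem12:
  fixes G :: "'a pair_pre_digraph" and k :: nat
  assumes "6 \<le> k"
    and "pair_graph G"
    and "planar_graph G"
    and "max_degree G \<le> k"
    and "\<not> (\<exists>p. pre_digraph.cycle (with_proj G) p \<and> length p = 4)"
  shows "total_group_choice_number TYPE('g) G \<le> k + 2"
  unfolding total_group_choice_number_def
    group_choice_number_le_iff[OF pair_graph_total_graph[OF assms(2)]]
  by (rule total_graph_choosable[OF assms(2,3,4,1) C4_free_uedges[OF assms(2,5)]])

end
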